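(* The operator algebra $\mathcal A\subset B(\mathcal H)$ constructed in the context is radical.
   Context: $\mathbb N=\{1,2,\dots\}$, $\mathbb N_0=\mathbb N\cup\{0\}$; $a\mid b$ means $a$ divides $b$ (so every $a\in\mathbb N$ divides $0$). Let $S$ be the free unital semigroup on two generators $g,h$, with unit $1$, and $S^-=S\setminus\{1\}$. For $s=\gamma_n\gamma_{n-1}\cdots\gamma_1$ with $\gamma_i\in\{g,h\}$, the length is $l(s)=n$, the depth is $\rho(s)=\#\{i:\gamma_i=h\}$, and, if $n>0$, the predecessor is $p(s)=\gamma_{n-1}\cdots\gamma_1$ (delete the leftmost letter); $p^j$ is the $j$-fold iterate of $p$. Weights: $w(s)=2^{-\rho(s)}$ and $W(s)=\prod_{j=0}^{l(s)-1}w(p^js)$ (so $W(1)=1$). $\mathcal H=l^2(S,W)$ is the Hilbert space of formal sums $\sum_{s\in S}x_s\cdot s$, $x_s\in\mathbb C$, with $\|\sum x_s\cdot s\|^2=\sum_{s\in S}W(s)^2|x_s|^2<\infty$; thus $S$ is an orthogonal basis with $\|s\|=W(s)$. Colour set: $\mathcal C=\{g^k:k\in\mathbb N\}\cup\{g^khs:k\in\mathbb N_0,\ s\in S,\ 1+l(s)\mid k\}\subset S^-$. The colour map $\mu:S^-\to\mathcal C$ is defined recursively: $\mu(s)=s$ if $s\in\mathcal C$; otherwise $s=g^khy$ with $y\in S$, $l(y)=n$, $(n+1)\nmid k$, and $\mu(s)=\mu(p^{n-k'}y)$, where $1\le k'\le n$ and $k\equiv k'\pmod{n+1}$. (For each $s\in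 S$, $\mu(gs)\ne\mu(hs)$.) For $c\in\mathcal C$, $T_c\in B(\mathcal H)$ is the bounded linear map with, for $s\in S$, $T_c(s)=gs$ if $\mu(gs)=c$, $T_c(s)=hs$ if $\mu(hs)=c$, and $T_c(s)=0$ otherwise. $\mathcal A_0$ is the non-unital subalgebra of $B(\mathcal H)$ generated by $\{T_c:c\in\mathcal C\}$, and $\mathcal A$ is its norm closure in $B(\mathcal H)$. A Banach algebra is radical if it equals its Jacobson radical, equivalently if every element is quasinilpotent. *)

theory Defs
  imports "HOL-Analysis.Analysis"
begin

section \<open>The free unital semigroup on two generators\<close>

datatype letter = G | H

text \<open>The head of the list is the leftmost letter, so \<open>\<gamma> # s\<close> is the product of the generator
  \<open>\<gamma>\<close> with \<open>s\<close>, the predecessor of a nonempty word is its \<^const>\<open>tl\<close>, and \<open>[]\<close> is the unit.\<close>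

type_synonym word = "letter list"

definition depth :: "word \<Rightarrow> nat"
  where "depth s = count_list s H"

definition weight :: "word \<Rightarrow> real"
  where "weight s = 1 / 2 ^ depth s"

definition Weight :: "word \<Rightarrow> real"
  where "Weight s = (\<Prod>j<length s. weight ((tl ^^ j) s))"

lemma weight_pos: "0 < weight s" and weight_le_1: "weight s \<le> 1"
  by (auto simp: weight_def)

lemma Weight_Nil [simp]: "Weight [] = 1"
  by (simp add: Weight_def)

lemma Weight_Cons: "Weight (a # s) = weight (a # s) * Weight s"
  unfolding Weight_def by (simp add: prod.lessThan_Suc_shift funpow_swap1 del: prod.lessThan_Suc)

lemma Weight_pos: "0 < Weight s"
  by (simp add: Weight_def prod_pos weight_pos)

lemma Weight_Cons_le: "Weight (a # s) \<le> Weight s"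
  using Weight_pos[of s] weight_le_1[of "a # s"] by (simp add: Weight_Cons)


section \<open>Colours\<close>

definition colours :: "word set"
  where "colours = {replicate k G | k. 1 \<le> k} \<union>
                   {replicate k G @ H # s | k s. (1 + length s) dvd k}"

text \<open>Every word containing \<open>H\<close> is uniquely of the form \<open>replicate k G @ H # y\<close>; the two functions
  below select \<open>k\<close> and \<open>y\<close>.\<close>

definition initial_G :: "word \<Rightarrow> nat"
  where "initial_G s = length (takeWhile (\<lambda>a. a = G) s)"

definition after_H :: "word \<Rightarrow> word"
  where "after_H s = tl (dropWhile (\<lambda>a. a = G) s)"

lemma initial_G_eq [simp]: "initial_G (replicate k G @ H # y) = k"
  by (simp add: initial_G_def takeWhile_append)

lemma after_H_eq [simp]: "after_H (replicate k G @ H # y) = y"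
  by (simp add: after_H_def dropWhile_append)

lemma word_cases:
  obtains (all_G) k where "s = replicate k G" | (H) k y where "s = replicate k G @ H # y"
proof (cases "H \<in> set s")
  case True
  then obtain us vs where s: "s = us @ H # vs" "H \<notin> set us"
    by (metis split_list_first)
  have "a = G" if "a \<in> set us" for a using s that by (cases a) auto
  then have "us = replicate (length us) G" by (metis replicate_eqI)
  with s that show ?thesis by metis
next
  case False
  have "a = G" if "a \<in> set s" for a using False that by (cases a) auto
  then have "s = replicate (length s) G" by (metis replicate_eqI)
  with that show ?thesis by metis
qed

lemma Nil_not_colour: "[] \<notin> colours"
  by (auto simp: colours_def)

lemma length_after_H: "s \<noteq> [] \<Longrightarrow> length (after_H s) < length s"
  using length_dropWhile_le[of "\<lambda>a. a = G" s] by (cases s) (auto simp: after_H_def)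

lemma length_funpow_tl [simp]: "length ((tl ^^ n) xs) = length xs - n"
  by (induction n) auto

text \<open>The colour of the unit is undefined in the mathematics; \<open>[]\<close> is a dummy value.
  For the other words that are not colours, \<open>n + 1\<close> does not divide \<open>k\<close>, hence
  \<open>k mod (n + 1)\<close> is the unique \<open>k'\<close> with \<open>1 \<le> k' \<le> n\<close> congruent to \<open>k\<close> modulo \<open>n + 1\<close>.\<close>

function \<mu> :: "word \<Rightarrow> word"
  where "\<mu> s = (if s = [] then []
                else if s \<in> colours then s
                else let k = initial_G s; y = after_H s; n = length y; k' = k mod (n + 1)
                     in \<mu> ((tl ^^ (n - k')) y))"
  by auto
termination
proof (relation "Wellfounded.measure length")
  fix s :: word and k y n k'
  assume "s \<noteq> []" "y = after_H s"
  then show "((tl ^^ (n - k')) y, s) \<in> Wellfounded.measure length"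
    using length_after_H[of s] by simp
qed simp

declare \<mu>.simps [simp del]

lemma \<mu>_colour: "s \<in> colours \<Longrightarrow> \<mu> s = s"
  using Nil_not_colour by (subst \<mu>.simps) auto

lemma \<mu>_rec:
  assumes "\<not> (length y + 1) dvd k" and "1 \<le> k'" and "k' \<le> length y"
    and "k mod (length y + 1) = k' mod (length y + 1)"
  shows "\<mu> (replicate k G @ H # y) = \<mu> ((tl ^^ (length y - k')) y)"
proof -
  have "replicate k G @ H # y \<notin> colours"
  proof
    assume "replicate k G @ H # y \<in> colours"
    then consider j where "replicate k G @ H # y = replicate j G"
      | j s where "replicate k G @ H # y = replicate j G @ H # s" "(1 + length s) dvd j"
      unfolding colours_def by blast
    then show False
    proof cases
      case 1
      have "H \<in> set (replicate j G)" unfolding 1[symmetric] by simp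
      then show False by simp
    next
      case 2
      then have "k = j" "y = s" by (metis initial_G_eq, metis after_H_eq)
      with 2 assms(1) show False by simp
    qed
  qed
  moreover have "k mod (length y + 1) = k'" using assms by simp
  ultimately show ?thesis by (subst \<mu>.simps) (simp add: Let_def)
qed

lemma \<mu>_in_colours:
  assumes "s \<noteq> []"
  shows "\<mu> s \<in> colours \<and> length (\<mu> s) \<le> length s"
  using assms
proof (induction s rule: length_induct)
  case (1 s)
  show ?case
  proof (cases "s \<in> colours")
    case True
    then show ?thesis by (simp add: \<mu>_colour)
  next
    case False
    show ?thesis
    proof (cases s rule: word_cases)
      case (all_G k)
      with "1.prems" have "1 \<le> k" by (cases k) auto
      then have "s \<in> colours" using all_G by (auto simp: colours_def)
      with False show ?thesis by simp
    next
      case (H k y)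
      define k' where "k' = k mod (length y + 1)"
      have nd: "\<not> (length y + 1) dvd k"
        using False H by (auto simp: colours_def)
      have k': "1 \<le> k'" "k' \<le> length y"
        using nd by (auto simp: k'_def dvd_eq_mod_eq_0 Suc_le_eq)
      have eq: "\<mu> s = \<mu> ((tl ^^ (length y - k')) y)"
        unfolding H by (rule \<mu>_rec) (use nd k' in \<open>auto simp: k'_def\<close>)
      let ?t = "(tl ^^ (length y - k')) y"
      have len: "length ?t = k'" using k' by simp
      then have "?t \<noteq> []" using k' by force
      moreover have less: "k' < length s" using k' H by simp
      ultimately have "\<mu> ?t \<in> colours \<and> length (\<mu> ?t) \<le> k'"
        using "1.IH"[rule_format, of ?t] len by simp
      then show ?thesis unfolding eq using less by simp
    qed
  qed
qed

lemma \<mu>_children_neq: "\<mu> (G # s) \<noteq> \<mu> (H # s)"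
proof
  assume eq: "\<mu> (G # s) = \<mu> (H # s)"
  have "H # s \<in> colours"
    by (auto simp: colours_def intro!: exI[of _ 0])
  then have h: "\<mu> (H # s) = H # s" by (rule \<mu>_colour)
  show False
  proof (cases "G # s \<in> colours")
    case True
    then show False using eq h \<mu>_colour by auto
  next
    case False
    then have "\<mu> (G # s) = \<mu> ((tl ^^ (length (after_H (G # s)) -
        initial_G (G # s) mod (length (after_H (G # s)) + 1))) (after_H (G # s)))"
      (is "_ = \<mu> ?t") by (subst \<mu>.simps) (simp add: Let_def)
    moreover have "length (\<mu> ?t) < length (G # s)"
    proof (cases "?t = []")
      case True
      then show ?thesis by (simp add: \<mu>.simps[of "[]"])
    next
      case False
      have "m - n < length (G # s)" if "m < length (G # s)" for m n
        using that by linarith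
      then have "length ?t < length (G # s)"
        using length_after_H[of "G # s"] unfolding length_funpow_tl by blast
      then show ?thesis using \<mu>_in_colours[OF False] by simp
    qed
    ultimately have "length (\<mu> (G # s)) < length (G # s)" by (simp only:)
    then show False by (simp add: eq h)
  qed
qed


section \<open>The Hilbert space\<close>

text \<open>A formal sum is represented by its family of coefficients.\<close>

typedef hilb = "{x :: word \<Rightarrow> complex. (\<lambda>s. (Weight s)\<^sup>2 * (cmod (x s))\<^sup>2) summable_on UNIV}"
  morphisms coeff Abs_hilb
  by (rule exI[of _ "\<lambda>_. 0"]) simp

setup_lifting type_definition_hilb

lemma summable_coeff: "(\<lambda>s. (Weight s)\<^sup>2 * (cmod (coeff x s))\<^sup>2) summable_on UNIV"
  using coeff[of x] by simp

lemma hilb_eqI: "(\<And>s. coeff x s = coeff y s) \<Longrightarrow> x = y"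
  by (simp add: coeff_inject[symmetric] fun_eq_iff)

lemma summable_cmp:
  fixes f g :: "'a \<Rightarrow> real"
  assumes "g summable_on A" "\<And>x. 0 \<le> f x" "\<And>x. f x \<le> g x"
  shows "f summable_on A"
  using assms(1) by (rule summable_on_comparison_test) (use assms in auto)

lemma cmod_add_sq_le: "(cmod (a + b))\<^sup>2 \<le> 2 * (cmod a)\<^sup>2 + 2 * (cmod b)\<^sup>2"
proof -
  have "(cmod (a + b))\<^sup>2 \<le> (cmod a + cmod b)\<^sup>2"
    by (intro power_mono norm_triangle_ineq) auto
  also have "\<dots> \<le> 2 * (cmod a)\<^sup>2 + 2 * (cmod b)\<^sup>2"
    using zero_le_power2[of "cmod a - cmod b"] by (simp add: power2_eq_square algebra_simps)
  finally show ?thesis .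
qed

lemma summable_add_aux:
  assumes "(\<lambda>s. (Weight s)\<^sup>2 * (cmod (x s))\<^sup>2) summable_on UNIV"
    and "(\<lambda>s. (Weight s)\<^sup>2 * (cmod (y s))\<^sup>2) summable_on UNIV"
  shows "(\<lambda>s. (Weight s)\<^sup>2 * (cmod (x s + y s))\<^sup>2) summable_on UNIV"
proof (rule summable_cmp)
  show "(\<lambda>s. 2 * ((Weight s)\<^sup>2 * (cmod (x s))\<^sup>2) + 2 * ((Weight s)\<^sup>2 * (cmod (y s))\<^sup>2)) summable_on UNIV"
    by (intro summable_on_add summable_on_cmult_right assms)
  show "(Weight s)\<^sup>2 * (cmod (x s + y s))\<^sup>2
      \<le> 2 * ((Weight s)\<^sup>2 * (cmod (x s))\<^sup>2) + 2 * ((Weight s)\<^sup>2 * (cmod (y s))\<^sup>2)" for s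
    using mult_left_mono[OF cmod_add_sq_le[of "x s" "y s"], of "(Weight s)\<^sup>2"]
    by (simp add: algebra_simps)
qed simp

lemma summable_cmult_aux:
  assumes "(\<lambda>s. (Weight s)\<^sup>2 * (cmod (x s))\<^sup>2) summable_on UNIV"
  shows "(\<lambda>s. (Weight s)\<^sup>2 * (cmod (c * x s))\<^sup>2) summable_on UNIV"
  using summable_on_cmult_right[OF assms, of "(cmod c)\<^sup>2"]
  by (simp add: norm_mult power_mult_distrib mult_ac)

lift_definition cscale :: "complex \<Rightarrow> hilb \<Rightarrow> hilb" is "\<lambda>c x s. c * x s"
  by (rule summable_cmult_aux)

instantiation hilb :: real_vector
begin

lift_definition zero_hilb :: hilb is "\<lambda>_. 0" by simp
lift_definition plus_hilb :: "hilb \<Rightarrow> hilb \<Rightarrow> hilb" is "\<lambda>x y s. x s + y s"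
  by (rule summable_add_aux)
lift_definition uminus_hilb :: "hilb \<Rightarrow> hilb" is "\<lambda>x s. - x s" by simp
definition minus_hilb :: "hilb \<Rightarrow> hilb \<Rightarrow> hilb" where "minus_hilb x y = x + - y"
definition scaleR_hilb :: "real \<Rightarrow> hilb \<Rightarrow> hilb" where "scaleR_hilb r = cscale (of_real r)"

instance
  by standard
    (auto intro!: hilb_eqI simp: plus_hilb.rep_eq zero_hilb.rep_eq uminus_hilb.rep_eq
      minus_hilb_def scaleR_hilb_def cscale.rep_eq algebra_simps)

end

lemmas coeff_simps [simp] = zero_hilb.rep_eq plus_hilb.rep_eq uminus_hilb.rep_eq cscale.rep_eq

lemma coeff_minus [simp]: "coeff (x - y) s = coeff x s - coeff y s"
  unfolding minus_hilb_def coeff_simps by (rule add_uminus_conv_diff)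

lemma coeff_scaleR [simp]: "coeff (r *\<^sub>R x) s = of_real r * coeff x s"
  by (simp add: scaleR_hilb_def)

lemma summable_inner:
  "(\<lambda>s. (Weight s)\<^sup>2 * (coeff x s \<bullet> coeff y s)) summable_on UNIV"
proof -
  have "(\<lambda>s. (1/2) * ((Weight s)\<^sup>2 * (cmod (coeff (x + y) s))\<^sup>2)
      + ((-1/2) * ((Weight s)\<^sup>2 * (cmod (coeff x s))\<^sup>2)
         + (-1/2) * ((Weight s)\<^sup>2 * (cmod (coeff y s))\<^sup>2))) summable_on UNIV"
    by (intro summable_on_add summable_on_cmult_right summable_coeff)
  moreover have "(1/2) * ((Weight s)\<^sup>2 * (cmod (coeff (x + y) s))\<^sup>2)
      + ((-1/2) * ((Weight s)\<^sup>2 * (cmod (coeff x s))\<^sup>2)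
         + (-1/2) * ((Weight s)\<^sup>2 * (cmod (coeff y s))\<^sup>2))
      = (Weight s)\<^sup>2 * (coeff x s \<bullet> coeff y s)" for s
    by (simp add: power2_norm_eq_inner inner_add_left inner_add_right inner_commute algebra_simps)
  ultimately show ?thesis by simp
qed

text \<open>The library has no class of complex inner product spaces; the inner product below is the
  real part of the complex one and induces the same norm.\<close>

instantiation hilb :: real_inner
begin

definition inner_hilb :: "hilb \<Rightarrow> hilb \<Rightarrow> real"
  where "inner_hilb x y = (\<Sum>\<^sub>\<infinity>s. (Weight s)\<^sup>2 * (coeff x s \<bullet> coeff y s))"
definition norm_hilb :: "hilb \<Rightarrow> real"
  where "norm_hilb x = sqrt (\<Sum>\<^sub>\<infinity>s. (Weight s)\<^sup>2 * (cmod (coeff x s))\<^sup>2)"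
definition sgn_hilb :: "hilb \<Rightarrow> hilb" where "sgn_hilb x = x /\<^sub>R norm x"
definition dist_hilb :: "hilb \<Rightarrow> hilb \<Rightarrow> real" where "dist_hilb x y = norm (x - y)"
definition uniformity_hilb :: "(hilb \<times> hilb) filter"
  where "uniformity_hilb = (INF e\<in>{0<..}. principal {(x, y). dist x y < e})"
definition open_hilb :: "hilb set \<Rightarrow> bool"
  where "open_hilb U \<longleftrightarrow> (\<forall>x\<in>U. \<forall>\<^sub>F (x', y) in uniformity. x' = x \<longrightarrow> y \<in> U)"

instance
proof
  fix x y z :: hilb and r :: real
  show "inner x y = inner y x"
    by (simp add: inner_hilb_def inner_commute)
  show "inner (x + y) z = inner x z + inner y z"
    unfolding inner_hilb_def
    by (subst infsum_add[OF summable_inner summable_inner, symmetric])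
      (simp add: inner_add_left distrib_left)
  have "coeff (r *\<^sub>R x) s = r *\<^sub>R coeff x s" for s
    by (simp add: scaleR_conv_of_real)
  then have "(Weight s)\<^sup>2 * (coeff (r *\<^sub>R x) s \<bullet> coeff y s)
      = r * ((Weight s)\<^sup>2 * (coeff x s \<bullet> coeff y s))" for s
    by (simp only: inner_scaleR_left mult.left_commute)
  then show "inner (r *\<^sub>R x) y = r * inner x y"
    unfolding inner_hilb_def by (simp only: infsum_cmult_right')
  show "0 \<le> inner x x"
    unfolding inner_hilb_def by (rule infsum_nonneg) simp
  show "inner x x = 0 \<longleftrightarrow> x = 0"
  proof
    assume "inner x x = 0"
    then have "(Weight s)\<^sup>2 * (coeff x s \<bullet> coeff x s) = 0" for s
      unfolding inner_hilb_def
      by (rule nonneg_infsum_le_0D[OF eq_refl summable_inner]) auto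
    then show "x = 0"
      using Weight_pos by (intro hilb_eqI) (simp add: less_le)
  qed (simp add: inner_hilb_def)
  show "norm x = sqrt (inner x x)"
    by (simp add: norm_hilb_def inner_hilb_def power2_norm_eq_inner)
qed (rule sgn_hilb_def dist_hilb_def uniformity_hilb_def open_hilb_def)+

end

lemma norm_hilb_sq: "(norm x)\<^sup>2 = (\<Sum>\<^sub>\<infinity>s. (Weight s)\<^sup>2 * (cmod (coeff x s))\<^sup>2)" for x :: hilb
  unfolding norm_hilb_def by (rule real_sqrt_pow2, rule infsum_nonneg) simp

lemma norm_hilb_partial:
  assumes "finite F"
  shows "(\<Sum>s\<in>F. (Weight s)\<^sup>2 * (cmod (coeff x s))\<^sup>2) \<le> (norm x)\<^sup>2"
  unfolding norm_hilb_sq using assms by (intro finite_sum_le_infsum summable_coeff) auto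

lemma norm_coeff_le: "Weight s * cmod (coeff x s) \<le> norm x"
  using norm_hilb_partial[of "{s}" x]
  by (simp add: power2_le_imp_le power_mult_distrib)

lemma hilb_partial_bound:
  assumes "\<And>F. finite F \<Longrightarrow> (\<Sum>s\<in>F. (Weight s)\<^sup>2 * (cmod (x s))\<^sup>2) \<le> B\<^sup>2" and "0 \<le> B"
  obtains z where "coeff z = x" "norm z \<le> B"
proof
  have sm: "(\<lambda>s. (Weight s)\<^sup>2 * (cmod (x s))\<^sup>2) summable_on UNIV"
  proof (rule nonneg_bdd_above_summable_on)
    show "bdd_above (sum (\<lambda>s. (Weight s)\<^sup>2 * (cmod (x s))\<^sup>2) ` {F. F \<subseteq> UNIV \<and> finite F})"
      by (rule bdd_aboveI2[where M = "B\<^sup>2"]) (rule assms(1), blast)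
  qed simp
  then show eq: "coeff (Abs_hilb x) = x"
    by (simp add: Abs_hilb_inverse)
  have "(norm (Abs_hilb x))\<^sup>2 \<le> B\<^sup>2"
    unfolding norm_hilb_sq eq by (rule infsum_le_finite_sums[OF sm assms(1)])
  then show "norm (Abs_hilb x) \<le> B"
    using assms(2) by (rule power2_le_imp_le)
qed

instance hilb :: banach
proof
  fix X :: "nat \<Rightarrow> hilb"
  assume X: "Cauchy X"
  have "Cauchy (\<lambda>n. coeff (X n) s)" for s
  proof (rule metric_CauchyI)
    fix e :: real assume "0 < e"
    then have "0 < Weight s * e" using Weight_pos by simp
    then obtain M where M: "\<And>m n. m \<ge> M \<Longrightarrow> n \<ge> M \<Longrightarrow> dist (X m) (X n) < Weight s * e"
      using metric_CauchyD[OF X] by blast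
    have "dist (coeff (X m) s) (coeff (X n) s) < e" if "m \<ge> M" "n \<ge> M" for m n
    proof -
      have "Weight s * dist (coeff (X m) s) (coeff (X n) s) < Weight s * e"
        using norm_coeff_le[of s "X m - X n"] M[OF that] by (simp add: dist_norm)
      then show ?thesis using Weight_pos by simp
    qed
    then show "\<exists>M. \<forall>m\<ge>M. \<forall>n\<ge>M. dist (coeff (X m) s) (coeff (X n) s) < e" by blast
  qed
  then have "\<forall>s. \<exists>l. (\<lambda>n. coeff (X n) s) \<longlonglongrightarrow> l"
    using Cauchy_convergent_iff convergent_def by blast
  then obtain L where L: "\<And>s. (\<lambda>n. coeff (X n) s) \<longlonglongrightarrow> L s" by metis
  have key: "\<exists>M. \<forall>m\<ge>M. \<exists>z. coeff z = (\<lambda>s. coeff (X m) s - L s) \<and> norm z \<le> e"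
    if "0 < e" for e
  proof -
    obtain M where M: "\<And>m n. m \<ge> M \<Longrightarrow> n \<ge> M \<Longrightarrow> dist (X m) (X n) < e"
      using metric_CauchyD[OF X \<open>0 < e\<close>] by blast
    have "\<exists>z. coeff z = (\<lambda>s. coeff (X m) s - L s) \<and> norm z \<le> e" if "m \<ge> M" for m
    proof -
      have "(\<Sum>s\<in>F. (Weight s)\<^sup>2 * (cmod (coeff (X m) s - L s))\<^sup>2) \<le> e\<^sup>2" if "finite F" for F
      proof (rule LIMSEQ_le_const2)
        show "(\<lambda>n. \<Sum>s\<in>F. (Weight s)\<^sup>2 * (cmod (coeff (X m) s - coeff (X n) s))\<^sup>2)
            \<longlonglongrightarrow> (\<Sum>s\<in>F. (Weight s)\<^sup>2 * (cmod (coeff (X m) s - L s))\<^sup>2)"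
          by (intro tendsto_intros L)
        have "(\<Sum>s\<in>F. (Weight s)\<^sup>2 * (cmod (coeff (X m) s - coeff (X n) s))\<^sup>2) \<le> e\<^sup>2" if "n \<ge> M" for n
        proof -
          have "(\<Sum>s\<in>F. (Weight s)\<^sup>2 * (cmod (coeff (X m) s - coeff (X n) s))\<^sup>2) \<le> (norm (X m - X n))\<^sup>2"
            using norm_hilb_partial[OF \<open>finite F\<close>, of "X m - X n"] by simp
          also have "\<dots> \<le> e\<^sup>2"
            using M[OF \<open>m \<ge> M\<close> that] by (intro power_mono) (auto simp: dist_norm)
          finally show ?thesis .
        qed
        then show "\<exists>N. \<forall>n\<ge>N. (\<Sum>s\<in>F. (Weight s)\<^sup>2 * (cmod (coeff (X m) s - coeff (X n) s))\<^sup>2) \<le> e\<^sup>2"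
          by blast
      qed
      then obtain z where "coeff z = (\<lambda>s. coeff (X m) s - L s)" "norm z \<le> e"
        by (rule hilb_partial_bound) (use \<open>0 < e\<close> in auto)
      then show ?thesis by blast
    qed
    then show ?thesis by blast
  qed
  obtain m z where z: "coeff z = (\<lambda>s. coeff (X m) s - L s)"
    using key[of 1] by auto
  have Lz: "coeff (X m - z) = L" using z by auto
  have "X \<longlonglongrightarrow> X m - z"
  proof (rule metric_LIMSEQ_I)
    fix e :: real assume "0 < e"
    then obtain M where M: "\<And>n. n \<ge> M \<Longrightarrow> \<exists>y. coeff y = (\<lambda>s. coeff (X n) s - L s) \<and> norm y \<le> e / 2"
      using key[of "e / 2"] by auto
    have "dist (X n) (X m - z) < e" if "n \<ge> M" for n
    proof -
      obtain y where y: "coeff y = (\<lambda>s. coeff (X n) s - L s)" "norm y \<le> e / 2"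
        using M[OF \<open>n \<ge> M\<close>] by blast
      have "y = X n - (X m - z)" by (rule hilb_eqI) (simp add: y z)
      then show ?thesis using y \<open>0 < e\<close> by (simp add: dist_norm)
    qed
    then show "\<exists>M. \<forall>n\<ge>M. dist (X n) (X m - z) < e" by blast
  qed
  then show "convergent X" by (auto simp: convergent_def)
qed

lift_definition basis :: "word \<Rightarrow> hilb" is "\<lambda>s t. if t = s then 1 else 0"
proof -
  fix s :: word
  have "(\<lambda>t. (Weight t)\<^sup>2 * (cmod (if t = s then 1 else 0))\<^sup>2) summable_on {s}" by simp
  then show "(\<lambda>t. (Weight t)\<^sup>2 * (cmod (if t = s then 1 else 0))\<^sup>2) summable_on UNIV"
    by (rule summable_on_cong_neutral[THEN iffD1, rotated -1]) auto
qed

lemma norm_basis: "norm (basis s) = Weight s"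
proof -
  have "(\<Sum>\<^sub>\<infinity>t. (Weight t)\<^sup>2 * (cmod (coeff (basis s) t))\<^sup>2)
      = (\<Sum>\<^sub>\<infinity>t\<in>{s}. (Weight t)\<^sup>2 * (cmod (coeff (basis s) t))\<^sup>2)"
    by (rule infsum_cong_neutral) (auto simp: basis.rep_eq)
  then show ?thesis
    using Weight_pos[of s] by (simp add: norm_hilb_def basis.rep_eq)
qed


section \<open>The operators and the algebra they generate\<close>

text \<open>Since \<open>T\<^sub>c\<close> sends \<open>s\<close> to the child of \<open>s\<close> coloured \<open>c\<close>, if there is one, and to \<open>0\<close> otherwise,
  the coefficient of \<open>T\<^sub>c x\<close> at \<open>\<gamma> s\<close> is \<open>x\<^sub>s\<close> if \<open>\<mu> (\<gamma> s) = c\<close>, and \<open>0\<close> otherwise.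
  The lemma \<open>T_basis\<close> below gives the values on the basis.\<close>

definition push :: "word \<Rightarrow> (word \<Rightarrow> complex) \<Rightarrow> word \<Rightarrow> complex"
  where "push c x t = (case t of [] \<Rightarrow> 0 | \<gamma> # s \<Rightarrow> if \<mu> (\<gamma> # s) = c then x s else 0)"

lemma push_Nil [simp]: "push c x [] = 0"
  and push_Cons [simp]: "push c x (\<gamma> # s) = (if \<mu> (\<gamma> # s) = c then x s else 0)"
  by (simp_all add: push_def)

lemma push_bound:
  assumes "finite F"
  shows "(\<Sum>t\<in>F. (Weight t)\<^sup>2 * (cmod (push c (coeff x) t))\<^sup>2) \<le> (norm x)\<^sup>2"
proof -
  define E where "E = {t \<in> F. t \<noteq> [] \<and> \<mu> t = c}"
  have fE: "finite E" using assms by (simp add: E_def)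
  have inj: "inj_on tl E"
  proof (rule inj_onI)
    fix t u assume tu: "t \<in> E" "u \<in> E" "tl t = tl u"
    then obtain a b s where "t = a # s" "u = b # s"
      unfolding E_def by (cases t; cases u) auto
    with tu show "t = u"
      using \<mu>_children_neq[of s] unfolding E_def by (cases a; cases b) auto
  qed
  have "(\<Sum>t\<in>F. (Weight t)\<^sup>2 * (cmod (push c (coeff x) t))\<^sup>2)
      = (\<Sum>t\<in>E. (Weight t)\<^sup>2 * (cmod (push c (coeff x) t))\<^sup>2)"
  proof (rule sum.mono_neutral_right)
    show "\<forall>t\<in>F - E. (Weight t)\<^sup>2 * (cmod (push c (coeff x) t))\<^sup>2 = 0"
      by (auto simp: E_def push_def split: list.split)
  qed (use assms E_def in auto)
  also have "\<dots> \<le> (\<Sum>t\<in>E. (Weight (tl t))\<^sup>2 * (cmod (coeff x (tl t)))\<^sup>2)"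
  proof (rule sum_mono)
    fix t assume "t \<in> E"
    then obtain a s where t: "t = a # s" "\<mu> (a # s) = c"
      unfolding E_def by (cases t) auto
    have "(Weight t)\<^sup>2 \<le> (Weight s)\<^sup>2"
      unfolding t using Weight_Cons_le Weight_pos by (intro power_mono) (auto simp: less_imp_le)
    then show "(Weight t)\<^sup>2 * (cmod (push c (coeff x) t))\<^sup>2
        \<le> (Weight (tl t))\<^sup>2 * (cmod (coeff x (tl t)))\<^sup>2"
      using t by (simp add: mult_right_mono)
  qed
  also have "\<dots> = (\<Sum>s\<in>tl ` E. (Weight s)\<^sup>2 * (cmod (coeff x s))\<^sup>2)"
    using inj by (simp add: sum.reindex)
  also have "\<dots> \<le> (norm x)\<^sup>2"
    using fE by (intro norm_hilb_partial) simp
  finally show ?thesis .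
qed

definition push_hilb :: "word \<Rightarrow> hilb \<Rightarrow> hilb"
  where "push_hilb c x = Abs_hilb (push c (coeff x))"

lemma coeff_push_hilb [simp]: "coeff (push_hilb c x) = push c (coeff x)"
  and norm_push_hilb: "norm (push_hilb c x) \<le> norm x"
proof -
  obtain z where z: "coeff z = push c (coeff x)" "norm z \<le> norm x"
    by (rule hilb_partial_bound[OF push_bound norm_ge_zero])
  then have "push_hilb c x = z"
    unfolding push_hilb_def by (metis coeff_inverse)
  with z show "coeff (push_hilb c x) = push c (coeff x)" "norm (push_hilb c x) \<le> norm x"
    by auto
qed

lift_definition T :: "word \<Rightarrow> hilb \<Rightarrow>\<^sub>L hilb" is push_hilb
proof (rule bounded_linear_intro[where K = 1])
  fix c x y and r :: real
  show "push_hilb c (x + y) = push_hilb c x + push_hilb c y"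
    by (rule hilb_eqI) (simp add: push_def split: list.split)
  show "push_hilb c (r *\<^sub>R x) = r *\<^sub>R push_hilb c x"
    by (rule hilb_eqI) (simp add: push_def split: list.split)
  show "norm (push_hilb c x) \<le> norm x * 1"
    by (simp add: norm_push_hilb)
qed

lemma T_basis:
  "T c (basis s) = (if \<mu> (G # s) = c then basis (G # s)
                    else if \<mu> (H # s) = c then basis (H # s) else 0)"
proof (rule hilb_eqI)
  fix t
  show "coeff (T c (basis s)) t = coeff (if \<mu> (G # s) = c then basis (G # s)
                    else if \<mu> (H # s) = c then basis (H # s) else 0) t"
  proof (cases t)
    case (Cons a u)
    then show ?thesis
      using \<mu>_children_neq[of s] by (cases a) (auto simp: T.rep_eq basis.rep_eq)
  qed (auto simp: T.rep_eq basis.rep_eq)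
qed

lift_definition cscale_op :: "complex \<Rightarrow> hilb \<Rightarrow>\<^sub>L hilb" is cscale
proof (rule bounded_linear_intro)
  fix c x y and r :: real
  show "cscale c (x + y) = cscale c x + cscale c y"
    by (rule hilb_eqI) (simp add: algebra_simps)
  show "cscale c (r *\<^sub>R x) = r *\<^sub>R cscale c x"
    by (rule hilb_eqI) simp
  have "(norm (cscale c x))\<^sup>2 = (norm x * cmod c)\<^sup>2"
    unfolding norm_hilb_sq power_mult_distrib
    by (subst infsum_cmult_left'[symmetric])
      (simp add: norm_mult power_mult_distrib mult_ac)
  then show "norm (cscale c x) \<le> norm x * cmod c"
    by (simp add: power2_eq_iff_nonneg)
qed

text \<open>The type \<open>hilb \<Rightarrow>\<^sub>L hilb\<close> consists of the bounded \<^emph>\<open>real\<close>-linear operators with the operator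
  norm; \<open>\<B>\<close> is its closed subspace of complex-linear ones.\<close>

definition \<B> :: "(hilb \<Rightarrow>\<^sub>L hilb) set"
  where "\<B> = {A :: hilb \<Rightarrow>\<^sub>L hilb. \<forall>c x. A (cscale c x) = cscale c (A x)}"

text \<open>Subalgebras are complex and need not be unital. The scalar multiple \<open>c A\<close> is
  \<open>cscale_op c o\<^sub>L A\<close>.\<close>

definition subalgebra :: "(hilb \<Rightarrow>\<^sub>L hilb) set \<Rightarrow> bool"
  where "subalgebra B \<longleftrightarrow> B \<subseteq> \<B> \<and> 0 \<in> B \<and>
    (\<forall>A\<in>B. \<forall>A'\<in>B. A + A' \<in> B) \<and>
    (\<forall>c. \<forall>A\<in>B. cscale_op c o\<^sub>L A \<in> B) \<and>
    (\<forall>A\<in>B. \<forall>A'\<in>B. A o\<^sub>L A' \<in> B)"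

definition \<A>\<^sub>0 :: "(hilb \<Rightarrow>\<^sub>L hilb) set"
  where "\<A>\<^sub>0 = subalgebra hull (T ` colours)"

definition \<A> :: "(hilb \<Rightarrow>\<^sub>L hilb) set"
  where "\<A> = closure \<A>\<^sub>0"

lemma T_in_\<B>: "T c \<in> \<B>"
  unfolding \<B>_def
  by (auto intro!: hilb_eqI simp: T.rep_eq push_def split: list.split)

lemma subalgebra_\<B>: "subalgebra \<B>"
  unfolding subalgebra_def \<B>_def
  by (auto intro!: hilb_eqI simp: blinfun.add_left cscale_op.rep_eq algebra_simps)

lemma subalgebra_\<A>\<^sub>0: "subalgebra \<A>\<^sub>0"
proof -
  have "T ` colours \<subseteq> \<B>" using T_in_\<B> by auto
  then have "\<A>\<^sub>0 \<subseteq> \<B>"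
    unfolding \<A>\<^sub>0_def by (intro hull_minimal subalgebra_\<B>)
  then show ?thesis
    unfolding \<A>\<^sub>0_def hull_def subalgebra_def by auto
qed

lemma closed_\<B>: "closed \<B>"
proof -
  have eq: "\<B> = (\<Inter>c. \<Inter>x. {A :: hilb \<Rightarrow>\<^sub>L hilb. A (cscale c x) = cscale_op c (A x)})"
    by (auto simp: \<B>_def cscale_op.rep_eq)
  show ?thesis
    unfolding eq by (intro closed_INT ballI closed_Collect_eq continuous_intros)
qed

lemma subalgebra_\<A>: "subalgebra \<A>"
  unfolding subalgebra_def
proof (intro conjI ballI allI)
  note sub = subalgebra_\<A>\<^sub>0[unfolded subalgebra_def]
  show "\<A> \<subseteq> \<B>"
    unfolding \<A>_def using sub closed_\<B> by (simp add: closure_minimal)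
  show "0 \<in> \<A>"
    unfolding \<A>_def using sub closure_subset by blast
  fix A A' c
  assume "A \<in> \<A>" "A' \<in> \<A>"
  then obtain X Y where XY: "\<And>n. X n \<in> \<A>\<^sub>0" "X \<longlonglongrightarrow> A" "\<And>n. Y n \<in> \<A>\<^sub>0" "Y \<longlonglongrightarrow> A'"
    unfolding \<A>_def closure_sequential by metis
  have "(\<lambda>n. X n + Y n) \<longlonglongrightarrow> A + A'" by (intro tendsto_intros XY)
  then show "A + A' \<in> \<A>"
    unfolding \<A>_def closure_sequential using sub XY by (intro exI[of _ "\<lambda>n. X n + Y n"]) simp
  have "(\<lambda>n. X n o\<^sub>L Y n) \<longlonglongrightarrow> (A o\<^sub>L A')" by (intro tendsto_intros XY)
  then show "A o\<^sub>L A' \<in> \<A>"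
    unfolding \<A>_def closure_sequential using sub XY by (intro exI[of _ "\<lambda>n. X n o\<^sub>L Y n"]) simp
next
  note sub = subalgebra_\<A>\<^sub>0[unfolded subalgebra_def]
  fix A c
  assume "A \<in> \<A>"
  then obtain X where X: "\<And>n. X n \<in> \<A>\<^sub>0" "X \<longlonglongrightarrow> A"
    unfolding \<A>_def closure_sequential by metis
  have "(\<lambda>n. cscale_op c o\<^sub>L X n) \<longlonglongrightarrow> (cscale_op c o\<^sub>L A)" by (intro tendsto_intros X)
  then show "cscale_op c o\<^sub>L A \<in> \<A>"
    unfolding \<A>_def closure_sequential using sub X
    by (intro exI[of _ "\<lambda>n. cscale_op c o\<^sub>L X n"]) simp
qed


section \<open>The Jacobson radical\<close>

definition left_ideal :: "(hilb \<Rightarrow>\<^sub>L hilb) set \<Rightarrow> (hilb \<Rightarrow>\<^sub>L hilb) set \<Rightarrow> bool"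
  where "left_ideal B L \<longleftrightarrow> L \<subseteq> B \<and> 0 \<in> L \<and>
    (\<forall>X\<in>L. \<forall>Y\<in>L. X + Y \<in> L) \<and>
    (\<forall>c. \<forall>X\<in>L. cscale_op c o\<^sub>L X \<in> L) \<and>
    (\<forall>A\<in>B. \<forall>X\<in>L. A o\<^sub>L X \<in> L)"

definition modular_left_ideal :: "(hilb \<Rightarrow>\<^sub>L hilb) set \<Rightarrow> (hilb \<Rightarrow>\<^sub>L hilb) set \<Rightarrow> bool"
  where "modular_left_ideal B L \<longleftrightarrow> left_ideal B L \<and> (\<exists>U\<in>B. \<forall>A\<in>B. A - (A o\<^sub>L U) \<in> L)"

definition maximal_modular_left_ideal :: "(hilb \<Rightarrow>\<^sub>L hilb) set \<Rightarrow> (hilb \<Rightarrow>\<^sub>L hilb) set \<Rightarrow> bool"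
  where "maximal_modular_left_ideal B L \<longleftrightarrow> modular_left_ideal B L \<and> L \<noteq> B \<and>
    (\<forall>L'. left_ideal B L' \<and> L \<subseteq> L' \<and> L' \<noteq> B \<longrightarrow> L' = L)"

text \<open>For a non-unital algebra the Jacobson radical is the intersection of the maximal modular
  left ideals, understood to be the whole algebra if there are none.\<close>

definition jacobson_radical :: "(hilb \<Rightarrow>\<^sub>L hilb) set \<Rightarrow> (hilb \<Rightarrow>\<^sub>L hilb) set"
  where "jacobson_radical B = B \<inter> \<Inter>{L. maximal_modular_left_ideal B L}"

definition radical_algebra :: "(hilb \<Rightarrow>\<^sub>L hilb) set \<Rightarrow> bool"
  where "radical_algebra B \<longleftrightarrow> jacobson_radical B = B"

end

theory Submission
  imports Defs "HOL-Library.Sublist"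
begin

text \<open>The algebra has no proper modular left ideal, hence is its own Jacobson radical, as soon as every
  \<open>U \<in> \<A>\<close> has a left quasi-inverse. The series \<open>U + U\<^sup>2 + \<dots>\<close> provides one if
  \<open>\<Sum>\<parallel>U\<^sup>n\<parallel>\<close> converges (\<open>left_quasi_inverse\<close>), so that everything rests on this convergence
  (\<open>summable_norm_opow\<close>). Quasinilpotence on \<open>\<A>\<^sub>0\<close> would not suffice for it: the
  spectral radius is not continuous, so the elements of the closure need an argument of their own.

  Words are the vertices of a binary tree with root \<open>[]\<close>, and every operator in \<open>\<A>\<close> moves mass from
  a word only to its descendants. Compression to a path-convex set of words is therefore
  multiplicative on \<open>\<A>\<close>, and if such a set is cut into finitely many layers that can only be left
  upwards, an operator is block triangular, and summability of the norms of its powers on the whole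
  set follows from summability on each layer (\<open>summable_powers_filtration\<close>). The depth gives such
  layers. On the words of depth at least \<open>d\<close> each step costs a factor \<open>2\<^sup>-\<^sup>d\<close>, so \<open>U\<close> is a strict
  contraction there for large \<open>d\<close>. It remains to treat the words of one depth \<open>j\<close>, by induction
  on \<open>j\<close>.

  Let \<open>E\<close> consist of the words of depth \<open>j\<close>; inside \<open>E\<close> one can only move along chains
  \<open>h y, g h y, g\<^sup>2 h y, \<dots>\<close> or, in depth \<open>0\<close>, along \<open>1, g, g\<^sup>2, \<dots>\<close>. The colouring is
  made so that, between two words that are their own colour, the colours met on such a chain are
  those of a piece of the path from the root to \<open>y\<close>, which has smaller depth; in depth \<open>0\<close> every
  nonempty word is its own colour (\<open>chain_copies_shallower_path\<close>). A power \<open>U\<^sup>k\<close> that is small on depth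
  less than \<open>j\<close> is approximated by an operator \<open>X\<close> generated by finitely many shifts. Only finitely
  many colours occur in \<open>X\<close>; cutting \<open>E\<close> where these occur as words leaves finitely many layers, on
  which \<open>X\<close> sees nothing but copies of shallower paths. A step on the chain is weighted at least
  twice as lightly as the copied one, so the \<open>m\<close>-th diagonal of \<open>X\<close> is at most \<open>2\<^sup>-\<^sup>m\<close> times the
  norm of \<open>X\<close> on smaller depth, and these bounds sum to that norm (\<open>norm_compression_level_le\<close>).
  Hence \<open>U\<^sup>k\<close> is a strict contraction on each layer, which closes the induction
  (\<open>summable_powers_depth_eq\<close>).\<close>


section \<open>Weighted estimates\<close>

lemma L2_set_coeff_le:
  assumes "finite F"
  shows "L2_set (\<lambda>s. Weight s * cmod (coeff x s)) F \<le> norm x"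
  using norm_hilb_partial[OF assms, of x]
  by (simp add: L2_set_def power_mult_distrib real_le_lsqrt)

lemma norm_hilb_leI:
  assumes "\<And>F. finite F \<Longrightarrow> L2_set (\<lambda>s. Weight s * cmod (coeff x s)) F \<le> B"
  shows "norm x \<le> B"
proof -
  have "0 \<le> B" using assms[of "{}"] by simp
  have "(\<Sum>s\<in>F. (Weight s)\<^sup>2 * (cmod (coeff x s))\<^sup>2) \<le> B\<^sup>2" if "finite F" for F
    using assms[OF that] by (simp add: L2_set_def power_mult_distrib sqrt_le_D)
  then obtain z where "coeff z = coeff x" "norm z \<le> B"
    using hilb_partial_bound \<open>0 \<le> B\<close> by metis
  then show ?thesis by (simp add: coeff_inject)
qed

lemma L2_set_sum_le: "L2_set (\<lambda>t. \<Sum>m\<in>M. f m t) A \<le> (\<Sum>m\<in>M. L2_set (f m) A)"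
proof (induction M rule: infinite_finite_induct)
  case (insert m M)
  have "L2_set (\<lambda>t. f m t + (\<Sum>m\<in>M. f m t)) A \<le> L2_set (f m) A + L2_set (\<lambda>t. \<Sum>m\<in>M. f m t) A"
    by (rule L2_set_triangle_ineq)
  with insert show ?case by simp
qed (simp_all add: L2_set_def)

text \<open>The \<open>m\<close>-th term of the hypothesis is \<open>a m\<close> times a weighted partial shift, which moves the mass at
  \<open>drop m t\<close> to \<open>t\<close>. By injectivity such a shift does not increase the norm, so the triangle
  inequality gives the sum of the \<open>a m\<close> as a bound.\<close>
lemma norm_le_of_shift_bound:
  assumes le: "\<And>t. Weight t * cmod (coeff z t)
      \<le> (\<Sum>m\<le>length t. a m * (if R m t then Weight (drop m t) * cmod (coeff x (drop m t)) else 0))"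
    and a: "\<And>m. 0 \<le> a m" and C: "\<And>N. (\<Sum>m\<le>N. a m) \<le> C"
    and inj: "\<And>m. inj_on (drop m) {t. R m t \<and> m \<le> length t}"
  shows "norm z \<le> C * norm x"
proof (rule norm_hilb_leI)
  fix F :: "word set" assume F: "finite F"
  define b where "b m t = (if R m t \<and> m \<le> length t
    then Weight (drop m t) * cmod (coeff x (drop m t)) else 0)" for m t
  define N where "N = Max (insert 0 (length ` F))"
  have N: "length t \<le> N" if "t \<in> F" for t
    unfolding N_def using F that by (intro Max_ge) auto
  have b_le: "L2_set (b m) F \<le> norm x" for m
  proof -
    define F' where "F' = {t \<in> F. R m t \<and> m \<le> length t}"
    have "inj_on (drop m) F'"
      by (rule inj_on_subset[OF inj]) (auto simp: F'_def)
    then have "(\<Sum>t\<in>F'. (Weight (drop m t) * cmod (coeff x (drop m t)))\<^sup>2)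
        = (\<Sum>s\<in>drop m ` F'. (Weight s * cmod (coeff x s))\<^sup>2)"
      by (simp add: sum.reindex)
    moreover have "(\<Sum>t\<in>F. (b m t)\<^sup>2) = (\<Sum>t\<in>F'. (Weight (drop m t) * cmod (coeff x (drop m t)))\<^sup>2)"
      unfolding F'_def using F by (intro sum.mono_neutral_cong_right) (auto simp: b_def)
    ultimately have "L2_set (b m) F = L2_set (\<lambda>s. Weight s * cmod (coeff x s)) (drop m ` F')"
      by (simp add: L2_set_def)
    also have "\<dots> \<le> norm x"
      using F by (intro L2_set_coeff_le) (simp add: F'_def)
    finally show ?thesis .
  qed
  have "Weight t * cmod (coeff z t) \<le> (\<Sum>m\<le>N. a m * b m t)" if "t \<in> F" for t
  proof -
    have "(\<Sum>m\<le>length t. a m * (if R m t then Weight (drop m t) * cmod (coeff x (drop m t)) else 0))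
        = (\<Sum>m\<le>N. a m * b m t)"
      using N[OF that] by (intro sum.mono_neutral_cong_left) (auto simp: b_def)
    with le[of t] show ?thesis by simp
  qed
  then have "L2_set (\<lambda>t. Weight t * cmod (coeff z t)) F \<le> L2_set (\<lambda>t. \<Sum>m\<le>N. a m * b m t) F"
    using Weight_pos by (intro L2_set_mono) (auto simp: less_imp_le)
  also have "\<dots> \<le> (\<Sum>m\<le>N. L2_set (\<lambda>t. a m * b m t) F)"
    by (rule L2_set_sum_le)
  also have "\<dots> = (\<Sum>m\<le>N. a m * L2_set (b m) F)"
    using a by (simp add: L2_set_right_distrib)
  also have "\<dots> \<le> (\<Sum>m\<le>N. a m * norm x)"
    by (intro sum_mono mult_left_mono b_le a)
  also have "\<dots> \<le> C * norm x"
    unfolding sum_distrib_right[symmetric] by (intro mult_right_mono C) simp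
  finally show "L2_set (\<lambda>t. Weight t * cmod (coeff z t)) F \<le> C * norm x" .
qed


section \<open>Compressions of tree-local operators\<close>

lemma summable_restrict:
  assumes "(\<lambda>s. (Weight s)\<^sup>2 * (cmod (x s))\<^sup>2) summable_on UNIV"
  shows "(\<lambda>s. (Weight s)\<^sup>2 * (cmod (if s \<in> E then x s else 0))\<^sup>2) summable_on UNIV"
  using assms by (rule summable_cmp) auto

lift_definition proj_hilb :: "word set \<Rightarrow> hilb \<Rightarrow> hilb" is "\<lambda>E x s. if s \<in> E then x s else 0"
  by (rule summable_restrict)

lemma norm_proj_hilb: "norm (proj_hilb E x) \<le> norm x"
proof (rule norm_hilb_leI)
  fix F :: "word set" assume "finite F"
  have "L2_set (\<lambda>s. Weight s * cmod (coeff (proj_hilb E x) s)) F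
      \<le> L2_set (\<lambda>s. Weight s * cmod (coeff x s)) F"
    using Weight_pos by (intro L2_set_mono) (auto simp: proj_hilb.rep_eq less_imp_le)
  also have "\<dots> \<le> norm x" by (rule L2_set_coeff_le) fact
  finally show "L2_set (\<lambda>s. Weight s * cmod (coeff (proj_hilb E x) s)) F \<le> norm x" .
qed

lift_definition proj :: "word set \<Rightarrow> hilb \<Rightarrow>\<^sub>L hilb" is proj_hilb
proof (rule bounded_linear_intro[where K = 1])
  fix E x y and r :: real
  show "proj_hilb E (x + y) = proj_hilb E x + proj_hilb E y"
    by (rule hilb_eqI) (simp add: proj_hilb.rep_eq)
  show "proj_hilb E (r *\<^sub>R x) = r *\<^sub>R proj_hilb E x"
    by (rule hilb_eqI) (simp add: proj_hilb.rep_eq)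
  show "norm (proj_hilb E x) \<le> norm x * 1"
    by (simp add: norm_proj_hilb)
qed

lemma coeff_proj [simp]: "coeff (proj E x) s = (if s \<in> E then coeff x s else 0)"
  by (simp add: proj.rep_eq proj_hilb.rep_eq)

lemma norm_proj_le: "norm (proj E) \<le> 1"
  by (rule norm_blinfun_bound) (simp_all add: proj.rep_eq norm_proj_hilb)

definition compression :: "word set \<Rightarrow> (hilb \<Rightarrow>\<^sub>L hilb) \<Rightarrow> hilb \<Rightarrow>\<^sub>L hilb"
  where "compression E X = proj E o\<^sub>L X o\<^sub>L proj E"

lemma compression_apply [simp]: "compression E X x = proj E (X (proj E x))"
  by (simp add: compression_def)

lemma norm_compose_le:
  fixes X Y :: "hilb \<Rightarrow>\<^sub>L hilb"
  assumes "norm X \<le> a" "norm Y \<le> b"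
  shows "norm (X o\<^sub>L Y) \<le> a * b"
  using assms by (intro order_trans[OF norm_blinfun_compose] mult_mono) (auto intro: order_trans[OF norm_ge_zero])

lemma norm_compression_le: "norm (compression E X) \<le> norm X"
proof -
  have "norm (compression E X) \<le> (1 * norm X) * 1"
    unfolding compression_def by (intro norm_compose_le norm_proj_le order_refl)
  then show ?thesis by simp
qed

lemma compression_diff: "compression E (X - Y) = compression E X - compression E Y"
  by (rule blinfun_eqI) (simp add: blinfun.diff_left blinfun.diff_right)

lemma norm_compression_close: "norm (compression E X) \<le> norm (compression E Y) + norm (X - Y)"
proof -
  have "compression E X = compression E Y + compression E (X - Y)"
    by (simp add: compression_diff)
  then show ?thesis
    using norm_triangle_ineq[of "compression E Y" "compression E (X - Y)"]
      norm_compression_le[of E "X - Y"] by simp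
qed

text \<open>This is lower triangularity with respect to the suffix order: mass moves only from a word to its
  descendants.\<close>
definition tree_local :: "(hilb \<Rightarrow>\<^sub>L hilb) \<Rightarrow> bool"
  where "tree_local X \<longleftrightarrow>
    (\<forall>x t. (\<forall>s. suffix s t \<longrightarrow> coeff x s = 0) \<longrightarrow> coeff (X x) t = 0)"

lemma tree_local_cong:
  assumes "tree_local X" "\<And>s. suffix s t \<Longrightarrow> coeff x s = coeff y s"
  shows "coeff (X x) t = coeff (X y) t"
proof -
  have "coeff (X (x - y)) t = 0"
    using assms unfolding tree_local_def by simp
  then show ?thesis by (simp add: blinfun.diff_right)
qed

lemma tree_local_compose: "tree_local X \<Longrightarrow> tree_local Y \<Longrightarrow> tree_local (X o\<^sub>L Y)"
  unfolding tree_local_def by (metis blinfun_apply_blinfun_compose suffix_order.order_trans)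

text \<open>These are the sets that a path of the tree cannot leave and enter again.\<close>
definition path_convex :: "word set \<Rightarrow> bool"
  where "path_convex E \<longleftrightarrow> (\<forall>s u t. s \<in> E \<longrightarrow> t \<in> E \<longrightarrow> suffix s u \<longrightarrow> suffix u t \<longrightarrow> u \<in> E)"

text \<open>Mass that starts and ends in a path-convex set has never been outside of it, so a projection onto
  that set can be inserted between two tree-local operators.\<close>
lemma proj_between:
  assumes "path_convex E" "tree_local X" "tree_local Y" "A \<subseteq> E" "B \<subseteq> E"
  shows "proj B (X (proj E (Y (proj A x)))) = proj B (X (Y (proj A x)))"
proof (rule hilb_eqI)
  fix t
  have "coeff (X (proj E (Y (proj A x)))) t = coeff (X (Y (proj A x))) t" if "t \<in> E"
  proof (rule tree_local_cong[OF assms(2)])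
    fix u assume u: "suffix u t"
    have "coeff (Y (proj A x)) u = 0" if "u \<notin> E"
    proof -
      have "s \<notin> A" if "suffix s u" for s
        using assms(1,4) \<open>t \<in> E\<close> \<open>u \<notin> E\<close> u that unfolding path_convex_def by blast
      then show ?thesis
        using assms(3) unfolding tree_local_def by simp
    qed
    then show "coeff (proj E (Y (proj A x))) u = coeff (Y (proj A x)) u" by simp
  qed
  then show "coeff (proj B (X (proj E (Y (proj A x))))) t = coeff (proj B (X (Y (proj A x)))) t"
    using assms(5) by auto
qed

primrec opow :: "(hilb \<Rightarrow>\<^sub>L hilb) \<Rightarrow> nat \<Rightarrow> hilb \<Rightarrow>\<^sub>L hilb"
  where "opow X 0 = id_blinfun" | "opow X (Suc n) = X o\<^sub>L opow X n"

lemma opow_add: "opow X (m + n) = opow X m o\<^sub>L opow X n"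
  by (induction m) (auto intro: blinfun_eqI)

lemma tree_local_opow: "tree_local X \<Longrightarrow> tree_local (opow X n)"
  by (induction n) (auto intro: tree_local_compose simp: tree_local_def)

lemma compression_compose:
  assumes "path_convex E" "tree_local X" "tree_local Y"
  shows "compression E (X o\<^sub>L Y) = compression E X o\<^sub>L compression E Y"
proof (rule blinfun_eqI)
  fix x
  have pp: "proj E (proj E y) = proj E y" for y by (rule hilb_eqI) simp
  show "compression E (X o\<^sub>L Y) x = (compression E X o\<^sub>L compression E Y) x"
    using proj_between[OF assms order_refl order_refl, of x] by (simp add: pp)
qed

section \<open>Summability of compressed powers\<close>

definition summable_powers_on :: "word set \<Rightarrow> (hilb \<Rightarrow>\<^sub>L hilb) \<Rightarrow> bool"
  where "summable_powers_on E X \<longleftrightarrow> summable (\<lambda>n. norm (compression E (opow X n)))"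

text \<open>Division with remainder \<open>n = q k + r\<close> bounds \<open>a n\<close> by \<open>(a k)\<^sup>q a r\<close>, a geometric series for each
  of the \<open>k\<close> remainders.\<close>
lemma summable_submultiplicative:
  fixes a :: "nat \<Rightarrow> real"
  assumes sub: "\<And>m n. a (m + n) \<le> a m * a n" and nonneg: "\<And>n. 0 \<le> a n" and "a k < 1" "0 < k"
  shows "summable a"
proof -
  have pow: "a (q * k + r) \<le> a k ^ q * a r" for q r
  proof (induction q)
    case (Suc q)
    have "a (Suc q * k + r) \<le> a k * a (q * k + r)"
      using sub[of k "q * k + r"] by (simp add: add.assoc)
    also have "\<dots> \<le> a k * (a k ^ q * a r)"
      by (intro mult_left_mono Suc.IH nonneg)
    finally show ?case by (simp add: mult.assoc)
  qed simp
  define S where "S = (\<Sum>r<k. a r)"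
  have S: "0 \<le> S" unfolding S_def by (intro sum_nonneg nonneg)
  have "(\<Sum>n<N. norm (a n)) \<le> 1 / (1 - a k) * S" for N
  proof -
    have "(\<Sum>n<N. norm (a n)) = (\<Sum>n<N. a n)" using nonneg by simp
    also have "\<dots> \<le> (\<Sum>n<N * k. a n)"
      using nonneg \<open>0 < k\<close> by (intro sum_mono2) (auto intro: less_le_trans)
    also have "\<dots> = (\<Sum>q<N. \<Sum>n=q * k..<q * k + k. a n)"
      by (rule sum.nat_group[symmetric])
    also have "\<dots> = (\<Sum>q<N. \<Sum>r<k. a (q * k + r))"
    proof (rule sum.cong[OF refl])
      fix q
      show "(\<Sum>n=q * k..<q * k + k. a n) = (\<Sum>r<k. a (q * k + r))"
        using sum.shift_bounds_nat_ivl[of a 0 "q * k" k]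
        by (simp only: lessThan_atLeast0 add.commute[of _ "q * k"] add_0_right)
    qed
    also have "\<dots> \<le> (\<Sum>q<N. \<Sum>r<k. a k ^ q * a r)"
      by (intro sum_mono pow)
    also have "\<dots> = (\<Sum>q<N. a k ^ q) * S"
      by (simp add: S_def sum_product)
    also have "\<dots> \<le> 1 / (1 - a k) * S"
    proof (rule mult_right_mono[OF _ S])
      have r: "norm (a k) < 1" using nonneg \<open>a k < 1\<close> by simp
      have "(\<Sum>q<N. a k ^ q) \<le> (\<Sum>q. a k ^ q)"
        by (rule sum_le_suminf[OF summable_geometric[OF r]]) (use nonneg in auto)
      then show "(\<Sum>q<N. a k ^ q) \<le> 1 / (1 - a k)"
        by (simp only: suminf_geometric[OF r])
    qed
    finally show ?thesis .
  qed
  then have "(\<Sum>n<N. a n) \<le> 1 / (1 - a k) * S" for N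
    using nonneg by simp
  with nonneg show ?thesis by (rule summableI_nonneg_bounded)
qed

lemma summable_powers_of_contraction:
  assumes "path_convex E" "tree_local X" "0 < k" "norm (compression E (opow X k)) < 1"
  shows "summable_powers_on E X"
  unfolding summable_powers_on_def
proof (rule summable_submultiplicative[where k = k])
  fix m n
  have "compression E (opow X (m + n)) = compression E (opow X m) o\<^sub>L compression E (opow X n)"
    using assms by (simp add: opow_add compression_compose tree_local_opow)
  then show "norm (compression E (opow X (m + n)))
      \<le> norm (compression E (opow X m)) * norm (compression E (opow X n))"
    using norm_blinfun_compose by metis
qed (use assms in auto)

lemma convex_parts:
  assumes E: "path_convex (E1 \<union> E2)" and low: "\<And>s t. s \<in> E2 \<Longrightarrow> t \<in> E1 \<Longrightarrow> \<not> suffix s t"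
  shows "path_convex E1" "path_convex E2"
  using assms unfolding path_convex_def by blast+

text \<open>A path of \<open>n\<close> steps from \<open>E1\<close> to \<open>E2\<close> inside their union crosses over exactly once; the sum is over
  the number \<open>i\<close> of steps that follow the crossing.\<close>
lemma off_diagonal_power:
  assumes E: "path_convex (E1 \<union> E2)" and disj: "E1 \<inter> E2 = {}"
    and low: "\<And>s t. s \<in> E2 \<Longrightarrow> t \<in> E1 \<Longrightarrow> \<not> suffix s t"
    and X: "tree_local X"
  shows "proj E2 o\<^sub>L opow X n o\<^sub>L proj E1
    = (\<Sum>i<n. compression E2 (opow X i) o\<^sub>L X o\<^sub>L compression E1 (opow X (n - 1 - i)))"
proof (induction n)
  case 0
  have "proj E2 (proj E1 x) = 0" for x
    by (rule hilb_eqI) (use disj in auto)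
  then show ?case by (auto intro!: blinfun_eqI)
next
  case (Suc n)
  note conv = convex_parts[OF E low]
  have split: "proj (E1 \<union> E2) y = proj E1 y + proj E2 y" for y
    by (rule hilb_eqI) (use disj in auto)
  have pp: "proj E2 (proj E2 y) = proj E2 y" for y
    by (rule hilb_eqI) simp
  have "proj E2 o\<^sub>L opow X (Suc n) o\<^sub>L proj E1
      = (proj E2 o\<^sub>L X o\<^sub>L compression E1 (opow X n))
        + (compression E2 X o\<^sub>L (proj E2 o\<^sub>L opow X n o\<^sub>L proj E1))"
  proof (rule blinfun_eqI)
    fix x
    have "proj E2 (X (opow X n (proj E1 x))) = proj E2 (X (proj (E1 \<union> E2) (opow X n (proj E1 x))))"
      by (rule proj_between[OF E X tree_local_opow[OF X], symmetric]) auto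
    then show "(proj E2 o\<^sub>L opow X (Suc n) o\<^sub>L proj E1) x
      = ((proj E2 o\<^sub>L X o\<^sub>L compression E1 (opow X n))
        + (compression E2 X o\<^sub>L (proj E2 o\<^sub>L opow X n o\<^sub>L proj E1))) x"
      by (simp add: split blinfun.add_right blinfun.add_left pp)
  qed
  also have "proj E2 o\<^sub>L X o\<^sub>L compression E1 (opow X n)
      = compression E2 (opow X 0) o\<^sub>L X o\<^sub>L compression E1 (opow X n)"
    by (rule blinfun_eqI) (simp add: pp)
  also have "compression E2 X o\<^sub>L (proj E2 o\<^sub>L opow X n o\<^sub>L proj E1)
      = (\<Sum>i<n. compression E2 (opow X (Suc i)) o\<^sub>L X o\<^sub>L compression E1 (opow X (n - 1 - i)))"
  proof -
    have "compression E2 (opow X (Suc i)) = compression E2 X o\<^sub>L compression E2 (opow X i)" for i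
      using conv X by (simp add: compression_compose tree_local_opow)
    then show ?thesis
      unfolding Suc.IH
      by (auto intro!: blinfun_eqI simp: blinfun.sum_left blinfun.sum_right)
  qed
  finally show ?case
    by (simp add: sum.lessThan_Suc_shift del: sum.lessThan_Suc opow.simps)
qed

text \<open>By \<open>off_diagonal_power\<close> the norm of the off-diagonal block of the \<open>n\<close>-th power is bounded by a
  Cauchy product of the two summable diagonal sequences. Unlike mere convergence to zero,
  summability is inherited by Cauchy products.\<close>
lemma summable_powers_triangular:
  assumes E: "path_convex (E1 \<union> E2)" and disj: "E1 \<inter> E2 = {}"
    and low: "\<And>s t. s \<in> E2 \<Longrightarrow> t \<in> E1 \<Longrightarrow> \<not> suffix s t"
    and X: "tree_local X"
    and sum1: "summable_powers_on E1 X" and sum2: "summable_powers_on E2 X"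
  shows "summable_powers_on (E1 \<union> E2) X"
proof -
  define a where "a n = norm (compression E1 (opow X n))" for n
  define b where "b n = norm (compression E2 (opow X n))" for n
  define c where "c n = (\<Sum>i<n. b i * a (n - 1 - i))" for n
  have "norm (compression (E1 \<union> E2) (opow X n)) \<le> a n + b n + norm X * c n" for n
  proof -
    have split: "proj (E1 \<union> E2) y = proj E1 y + proj E2 y" for y
      by (rule hilb_eqI) (use disj in auto)
    have zero: "proj E1 (opow X n (proj E2 x)) = 0" for x
    proof (rule hilb_eqI)
      fix t
      show "coeff (proj E1 (opow X n (proj E2 x))) t = coeff 0 t"
        using low tree_local_opow[OF X, of n] unfolding tree_local_def by auto
    qed
    have eq: "compression (E1 \<union> E2) (opow X n)
        = compression E1 (opow X n) + compression E2 (opow X n) + (proj E2 o\<^sub>L opow X n o\<^sub>L proj E1)"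
      by (rule blinfun_eqI) (simp add: split zero blinfun.add_left blinfun.add_right)
    have "norm (proj E2 o\<^sub>L opow X n o\<^sub>L proj E1)
        \<le> (\<Sum>i<n. norm (compression E2 (opow X i) o\<^sub>L X o\<^sub>L compression E1 (opow X (n - 1 - i))))"
      using norm_sum[of _ "{..<n}"] by (simp only: off_diagonal_power[OF E disj low X])
    also have "\<dots> \<le> (\<Sum>i<n. (b i * norm X) * a (n - 1 - i))"
      unfolding a_def b_def by (intro sum_mono norm_compose_le order_refl)
    also have "\<dots> = norm X * c n"
      unfolding c_def sum_distrib_left by (simp add: mult_ac)
    finally show ?thesis
      unfolding eq a_def b_def
      by (intro order_trans[OF norm_triangle_ineq] add_mono) simp_all
  qed
  moreover have "summable (\<lambda>n. a n + b n + norm X * c n)"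
  proof -
    have "summable (\<lambda>n. \<Sum>i\<le>n. b i * a (n - i))"
      using sum1 sum2 unfolding summable_powers_on_def a_def b_def
      by (intro summable_Cauchy_product) simp_all
    then have "summable (\<lambda>n. c (Suc n))"
      by (simp add: c_def lessThan_Suc_atMost)
    then have "summable c" by (simp only: summable_Suc_iff)
    with sum1 sum2 show ?thesis
      unfolding summable_powers_on_def a_def b_def
      by (intro summable_add summable_mult)
  qed
  ultimately show ?thesis
    unfolding summable_powers_on_def
    by (auto intro!: summable_comparison_test'[where N = 0 and g = "\<lambda>n. a n + b n + norm X * c n"])
qed

lemma summable_powers_filtration:
  fixes f :: "word \<Rightarrow> nat"
  assumes E: "path_convex E" and mono: "\<And>s t. suffix s t \<Longrightarrow> f s \<le> f t" and X: "tree_local X"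
    and levels: "\<And>i. i < N \<Longrightarrow> summable_powers_on {s \<in> E. f s = i} X"
  shows "summable_powers_on {s \<in> E. f s < N} X"
  using levels
proof (induction N)
  case 0
  have "compression {} (opow X n) = 0" for n
    by (auto intro!: blinfun_eqI hilb_eqI)
  then show ?case by (simp add: summable_powers_on_def)
next
  case (Suc N)
  have eq: "{s \<in> E. f s < Suc N} = {s \<in> E. f s < N} \<union> {s \<in> E. f s = N}" by auto
  show ?case
    unfolding eq
  proof (rule summable_powers_triangular)
    show "path_convex ({s \<in> E. f s < N} \<union> {s \<in> E. f s = N})"
      unfolding path_convex_def eq[symmetric] mem_Collect_eq
      using E[unfolded path_convex_def] mono le_less_trans by blast
    show "\<not> suffix s t" if "s \<in> {s \<in> E. f s = N}" "t \<in> {s \<in> E. f s < N}" for s t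
      using that mono[of s t] by auto
    show "summable_powers_on {s \<in> E. f s < N} X"
      by (rule Suc.IH) (simp add: Suc.prems)
  qed (use Suc.prems X in auto)
qed


section \<open>Symbols of the operators generated by the shifts\<close>

definition path_colours :: "word \<Rightarrow> nat \<Rightarrow> word list"
  where "path_colours t m = map (\<lambda>i. \<mu> (drop i t)) [0..<m]"

lemma length_path_colours [simp]: "length (path_colours t m) = m"
  by (simp add: path_colours_def)

lemma path_colours_add: "path_colours t (m + k) = path_colours t m @ path_colours (drop m t) k"
  by (rule nth_equalityI) (auto simp: path_colours_def nth_append)

text \<open>The matrix entry of a polynomial in the shifts at the pair \<open>(t, s)\<close>, where \<open>s\<close> is a suffix of \<open>t\<close>,
  depends only on the sequence of colours on the path from \<open>s\<close> to \<open>t\<close>: it is the coefficient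
  \<open>\<Phi>\<close> of the monomial in the shifts with these colours. The condition on the empty sequence
  says that the polynomial has no constant term; \<open>F\<close> contains all colours that it involves.\<close>
definition has_symbol :: "(hilb \<Rightarrow>\<^sub>L hilb) \<Rightarrow> (word list \<Rightarrow> complex) \<Rightarrow> word set \<Rightarrow> bool"
  where "has_symbol X \<Phi> F \<longleftrightarrow> \<Phi> [] = 0 \<and> (\<forall>l. \<Phi> l \<noteq> 0 \<longrightarrow> set l \<subseteq> F) \<and>
    (\<forall>x t. coeff (X x) t = (\<Sum>m\<le>length t. \<Phi> (path_colours t m) * coeff x (drop m t)))"

lemma has_symbolD:
  assumes "has_symbol X \<Phi> F"
  shows "\<Phi> [] = 0" "\<Phi> l \<noteq> 0 \<Longrightarrow> set l \<subseteq> F"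
    "coeff (X x) t = (\<Sum>m\<le>length t. \<Phi> (path_colours t m) * coeff x (drop m t))"
  using assms unfolding has_symbol_def by blast+

lemma has_symbol_T: "has_symbol (T c) (\<lambda>l. if l = [c] then 1 else 0) {c}"
proof -
  have eq: "path_colours t m = [c] \<longleftrightarrow> m = 1 \<and> \<mu> t = c" for t m
  proof (cases "m = 1")
    case False
    then have "length (path_colours t m) \<noteq> length [c]" by simp
    with False show ?thesis by metis
  qed (simp add: path_colours_def)
  have "coeff (T c x) t
      = (\<Sum>m\<le>length t. (if path_colours t m = [c] then 1 else 0) * coeff x (drop m t))" for x t
  proof -
    have "(\<Sum>m\<le>length t. (if path_colours t m = [c] then 1 else 0) * coeff x (drop m t))
        = (\<Sum>m\<le>length t. if m = 1 then if \<mu> t = c then coeff x (drop 1 t) else 0 else 0)"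
      by (intro sum.cong refl) (simp add: eq)
    also have "\<dots> = (if 1 \<le> length t then if \<mu> t = c then coeff x (drop 1 t) else 0 else 0)"
      by (simp only: sum.delta[OF finite_atMost] atMost_iff)
    also have "\<dots> = coeff (T c x) t"
      by (cases t) (simp_all add: T.rep_eq)
    finally show ?thesis by (rule sym)
  qed
  then show ?thesis unfolding has_symbol_def by auto
qed

lemma has_symbol_add:
  assumes "has_symbol X \<Phi> F" "has_symbol Y \<Psi> F'"
  shows "has_symbol (X + Y) (\<lambda>l. \<Phi> l + \<Psi> l) (F \<union> F')"
  using has_symbolD[OF assms(1)] has_symbolD[OF assms(2)] unfolding has_symbol_def
  by (auto simp: blinfun.add_left distrib_right sum.distrib) (metis add_0 subsetD)

lemma has_symbol_scale:
  assumes "has_symbol X \<Phi> F"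
  shows "has_symbol (cscale_op c o\<^sub>L X) (\<lambda>l. c * \<Phi> l) F"
  using has_symbolD[OF assms] unfolding has_symbol_def
  by (auto simp: cscale_op.rep_eq sum_distrib_left mult.assoc)

text \<open>The symbol of a product is the convolution of the symbols with respect to concatenation.\<close>
lemma has_symbol_compose:
  assumes X: "has_symbol X \<Phi> F" and Y: "has_symbol Y \<Psi> F'"
  shows "has_symbol (X o\<^sub>L Y) (\<lambda>l. \<Sum>i\<le>length l. \<Phi> (take i l) * \<Psi> (drop i l)) (F \<union> F')"
  unfolding has_symbol_def
proof (intro conjI allI impI)
  show "(\<Sum>i\<le>length []. \<Phi> (take i []) * \<Psi> (drop i [])) = 0"
    using has_symbolD(1)[OF X] by simp
next
  fix l assume "(\<Sum>i\<le>length l. \<Phi> (take i l) * \<Psi> (drop i l)) \<noteq> 0"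
  then obtain i where "\<Phi> (take i l) \<noteq> 0" "\<Psi> (drop i l) \<noteq> 0"
    by (metis (no_types, lifting) mult_zero_left mult_zero_right sum.neutral)
  then have "set (take i l @ drop i l) \<subseteq> F \<union> F'"
    using has_symbolD(2)[OF X] has_symbolD(2)[OF Y] by (auto simp del: append_take_drop_id)
  then show "set l \<subseteq> F \<union> F'" by simp
next
  fix x t
  define g where "g m k = \<Phi> (path_colours t m) * \<Psi> (path_colours (drop m t) k)
    * coeff x (drop (m + k) t)" for m k
  have "coeff ((X o\<^sub>L Y) x) t = (\<Sum>m\<le>length t. \<Sum>k\<le>length t - m. g m k)"
    by (simp add: has_symbolD(3)[OF X] has_symbolD(3)[OF Y] g_def sum_distrib_left mult.assoc add.commute)
  also have "\<dots> = (\<Sum>(m, k)\<in>Sigma {..length t} (\<lambda>m. {..length t - m}). g m k)"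
    by (simp add: sum.Sigma)
  also have "Sigma {..length t} (\<lambda>m. {..length t - m}) = {(m, k). m + k \<le> length t}"
    by auto
  also have "(\<Sum>(m, k)\<in>{(m, k). m + k \<le> length t}. g m k) = (\<Sum>n\<le>length t. \<Sum>i\<le>n. g i (n - i))"
    by (rule sum.triangle_reindex_eq)
  also have "\<dots> = (\<Sum>n\<le>length t. (\<Sum>i\<le>length (path_colours t n).
      \<Phi> (take i (path_colours t n)) * \<Psi> (drop i (path_colours t n))) * coeff x (drop n t))"
    unfolding sum_distrib_right
  proof (intro sum.cong)
    fix n i assume "i \<in> {..length (path_colours t n)}"
    then have "path_colours t n = path_colours t i @ path_colours (drop i t) (n - i)"
      using path_colours_add[of t i "n - i"] by simp
    then have "take i (path_colours t n) = path_colours t i"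
      "drop i (path_colours t n) = path_colours (drop i t) (n - i)" by simp_all
    with \<open>i \<in> _\<close> show "g i (n - i) = \<Phi> (take i (path_colours t n)) * \<Psi> (drop i (path_colours t n))
        * coeff x (drop n t)"
      by (simp add: g_def)
  qed simp_all
  finally show "coeff ((X o\<^sub>L Y) x) t = (\<Sum>n\<le>length t. (\<Sum>i\<le>length (path_colours t n).
      \<Phi> (take i (path_colours t n)) * \<Psi> (drop i (path_colours t n))) * coeff x (drop n t))" .
qed

lemma \<A>\<^sub>0_induct [consumes 1, case_names generator zero add scale compose]:
  assumes "X \<in> \<A>\<^sub>0" and "\<And>c. P (T c)" and "P 0" and "\<And>X Y. P X \<Longrightarrow> P Y \<Longrightarrow> P (X + Y)"
    and "\<And>c X. P X \<Longrightarrow> P (cscale_op c o\<^sub>L X)" and "\<And>X Y. P X \<Longrightarrow> P Y \<Longrightarrow> P (X o\<^sub>L Y)"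
  shows "P X"
proof -
  have "subalgebra {X \<in> \<B>. P X}"
    using subalgebra_\<B> assms(3-6) unfolding subalgebra_def by blast
  moreover have "T ` colours \<subseteq> {X \<in> \<B>. P X}"
    using T_in_\<B> assms(2) by auto
  ultimately have "\<A>\<^sub>0 \<subseteq> {X \<in> \<B>. P X}"
    unfolding \<A>\<^sub>0_def by (intro hull_minimal)
  with assms(1) show ?thesis by blast
qed

lemma \<A>\<^sub>0_has_symbol:
  assumes "X \<in> \<A>\<^sub>0"
  shows "\<exists>\<Phi> F. finite F \<and> has_symbol X \<Phi> F"
  using assms
proof (induction rule: \<A>\<^sub>0_induct)
  case (generator c)
  then show ?case using has_symbol_T by blast
next
  case zero
  have "has_symbol 0 (\<lambda>_. 0) {}" by (simp add: has_symbol_def)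
  then show ?case by blast
next
  case (add X Y)
  then obtain \<Phi> F \<Psi> F' where "finite F" "has_symbol X \<Phi> F" "finite F'" "has_symbol Y \<Psi> F'"
    by blast
  then show ?case
    using has_symbol_add[of X \<Phi> F Y \<Psi> F'] finite_UnI[of F F'] by blast
next
  case (scale c X)
  then show ?case using has_symbol_scale by blast
next
  case (compose X Y)
  then obtain \<Phi> F \<Psi> F' where "finite F" "has_symbol X \<Phi> F" "finite F'" "has_symbol Y \<Psi> F'"
    by blast
  then show ?case
    using has_symbol_compose[of X \<Phi> F Y \<Psi> F'] finite_UnI[of F F'] by blast
qed

lemma has_symbol_tree_local: "has_symbol X \<Phi> F \<Longrightarrow> tree_local X"
  unfolding tree_local_def by (auto simp: has_symbolD(3) suffix_drop)

lemma \<A>_approx: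
  assumes "U \<in> \<A>" "0 < e"
  obtains X where "X \<in> \<A>\<^sub>0" "norm (U - X) < e"
  using assms unfolding \<A>_def closure_approachable dist_norm by (metis norm_minus_commute)

lemma \<A>_tree_local:
  assumes "U \<in> \<A>"
  shows "tree_local U"
  unfolding tree_local_def
proof (intro allI impI)
  fix x t assume x: "\<forall>s. suffix s t \<longrightarrow> coeff x s = 0"
  have "Weight t * cmod (coeff (U x) t) \<le> 0"
  proof (rule field_le_epsilon)
    fix e :: real assume "0 < e"
    then obtain X where X: "X \<in> \<A>\<^sub>0" "norm (U - X) < e / (norm x + 1)"
      using \<A>_approx[OF assms, of "e / (norm x + 1)"] by (auto simp: add_nonneg_pos)
    then have "coeff (X x) t = 0"
      using \<A>\<^sub>0_has_symbol has_symbol_tree_local x unfolding tree_local_def by blast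
    then have "coeff (U x) t = coeff ((U - X) x) t" by (simp add: blinfun.diff_left)
    then have "Weight t * cmod (coeff (U x) t) \<le> norm ((U - X) x)"
      using norm_coeff_le by metis
    also have "\<dots> \<le> norm (U - X) * norm x" by (rule norm_blinfun)
    also have "\<dots> \<le> e / (norm x + 1) * (norm x + 1)"
      using X(2) \<open>0 < e\<close> by (intro mult_mono) auto
    also have "\<dots> = e" by (simp add: add_nonneg_eq_0_iff)
    finally show "Weight t * cmod (coeff (U x) t) \<le> 0 + e" by simp
  qed
  then show "coeff (U x) t = 0"
    using Weight_pos[of t] by (simp add: mult_le_0_iff)
qed

text \<open>An entry of the matrix of the compression, with respect to the orthonormal basis obtained by
  normalising the words, is bounded by the norm.\<close>
lemma compression_entry:
  assumes X: "has_symbol X \<Phi> F" and E: "t \<in> E" "drop m t \<in> E" and m: "m \<le> length t"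
  shows "cmod (\<Phi> (path_colours t m)) * Weight t \<le> norm (compression E X) * Weight (drop m t)"
proof -
  have pb: "proj E (basis (drop m t)) = basis (drop m t)"
    by (rule hilb_eqI) (use E in \<open>auto simp: basis.rep_eq\<close>)
  have "drop k t = drop m t \<longleftrightarrow> k = m" if "k \<le> length t" for k
    using that m by (metis diff_diff_cancel length_drop)
  then have "(\<Sum>k\<le>length t. \<Phi> (path_colours t k) * coeff (basis (drop m t)) (drop k t))
      = (\<Sum>k\<le>length t. if k = m then \<Phi> (path_colours t m) else 0)"
    by (intro sum.cong refl) (auto simp: basis.rep_eq)
  moreover have "coeff (compression E X (basis (drop m t))) t
      = (\<Sum>k\<le>length t. \<Phi> (path_colours t k) * coeff (basis (drop m t)) (drop k t))"
    using E(1) by (simp add: pb flip: has_symbolD(3)[OF X])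
  ultimately have "coeff (compression E X (basis (drop m t))) t
      = (\<Sum>k\<le>length t. if k = m then \<Phi> (path_colours t m) else 0)"
    by simp
  then have "coeff (compression E X (basis (drop m t))) t = \<Phi> (path_colours t m)"
    using m by simp
  then have "Weight t * cmod (\<Phi> (path_colours t m)) \<le> norm (compression E X (basis (drop m t)))"
    using norm_coeff_le by metis
  also have "\<dots> \<le> norm (compression E X) * Weight (drop m t)"
    using norm_blinfun[of "compression E X" "basis (drop m t)"] by (simp only: norm_basis)
  finally show ?thesis by (simp add: mult.commute)
qed


section \<open>Chains copy shallower paths\<close>

lemma funpow_tl_eq_drop: "(tl ^^ n) xs = drop n xs"
  by (induction n) (simp_all add: drop_Suc tl_drop)

lemma depth_mono: "suffix s t \<Longrightarrow> depth s \<le> depth t"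
  by (auto simp: suffix_def depth_def)

lemma depth_replicate_G [simp]: "depth (replicate m G @ s) = depth s"
  by (induction m) (auto simp: depth_def)

lemma replicate_G_if_depth_eq:
  assumes "depth (drop m t) = depth t"
  shows "t = replicate (min m (length t)) G @ drop m t"
proof -
  have "depth t = count_list (take m t) H + depth (drop m t)"
    unfolding depth_def count_list_append[symmetric] by simp
  then have "H \<notin> set (take m t)"
    using assms by (simp add: count_list_0_iff)
  then have "a = G" if "a \<in> set (take m t)" for a
    using that by (cases a) auto
  then have "take m t = replicate (length (take m t)) G" by (metis replicate_eqI)
  then show ?thesis
    by (metis append_take_drop_id length_take min.commute)
qed

lemma Weight_replicate_G: "Weight (replicate m G @ s) = (1 / 2 ^ depth s) ^ m * Weight s"
proof (induction m)
  case (Suc m)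
  have "weight (G # replicate m G @ s) = 1 / 2 ^ depth s"
    using depth_replicate_G[of "Suc m" s] by (simp add: weight_def)
  with Suc show ?case by (simp add: Weight_Cons)
qed simp

text \<open>On the path up to \<open>t\<close> the depth never exceeds that of \<open>t\<close>, so each of the last \<open>m\<close> steps is weighted
  by at least \<open>2\<close> to the power \<open>- depth t\<close>.\<close>
lemma Weight_ge_drop: "(1 / 2 ^ depth t) ^ m * Weight (drop m t) \<le> Weight t"
proof (induction m arbitrary: t)
  case (Suc m)
  show ?case
  proof (cases t)
    case (Cons a u)
    have le: "depth u \<le> depth t" by (rule depth_mono) (simp add: Cons suffix_ConsI)
    have "(1 / 2 ^ depth t) ^ Suc m * Weight (drop (Suc m) t)
        = weight t * ((1 / 2 ^ depth t) ^ m * Weight (drop m u))"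
      by (simp add: Cons weight_def)
    also have "\<dots> \<le> weight t * ((1 / 2 ^ depth u) ^ m * Weight (drop m u))"
      using le Weight_pos weight_pos
      by (intro mult_left_mono mult_right_mono power_mono)
        (auto simp: less_imp_le frac_le power_increasing)
    also have "\<dots> \<le> weight t * Weight u"
      using weight_pos by (intro mult_left_mono Suc.IH) (auto simp: less_imp_le)
    also have "\<dots> = Weight t" by (simp add: Cons Weight_Cons)
    finally show ?thesis .
  qed (simp add: depth_def)
qed simp

text \<open>Put \<open>n = length y\<close>. On the chain \<open>g\<^sup>k h y\<close>, \<open>k = 0, 1, \<dots>\<close>, the words with \<open>n + 1\<close> dividing \<open>k\<close> are
  their own colours, while \<open>g\<^sup>k h y\<close> has the colour of the suffix of \<open>y\<close> of length
  \<open>k mod (n + 1)\<close> otherwise. As long as no multiple of \<open>n + 1\<close> is met, this length grows by one at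
  each step, and the suffixes of \<open>y\<close> so obtained form a path of smaller depth. A chain of words
  \<open>g\<^sup>k\<close> consists of words that are their own colours.\<close>
lemma chain_copies_shallower_path:
  assumes t: "t = replicate m G @ s" and m: "0 < m"
    and nonself: "\<And>i. i < m \<Longrightarrow> \<mu> (drop i t) \<noteq> drop i t"
  obtains t0 where "m \<le> length t0" "depth t0 < depth s" "path_colours t0 m = path_colours t m"
proof (cases s rule: word_cases)
  case (all_G k)
  then have "t = replicate (m + k) G" by (simp add: t replicate_add)
  with m have "t \<in> colours" unfolding colours_def by auto
  with nonself[of 0] m \<mu>_colour show ?thesis by simp
next
  case (H k y)
  define N where "N = length y + 1"
  define q where "q = k mod N"
  have t_drop: "drop i t = replicate (k + (m - i)) G @ H # y" if "i \<le> m" for i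
    using that by (simp add: t H replicate_add[symmetric] add.commute flip: append_assoc)
  have ndvd: "\<not> N dvd k + (m - i)" if "i < m" for i
  proof
    assume "N dvd k + (m - i)"
    then have "drop i t \<in> colours"
      using that unfolding t_drop[OF less_imp_le[OF that]] colours_def N_def by auto
    with nonself[OF that] \<mu>_colour show False by simp
  qed
  \<comment> \<open>Otherwise the exponents \<open>k + 1, \<dots>, k + m\<close> would include the next multiple of \<open>N\<close> after \<open>k\<close>.\<close>
  have qm: "q + m < N"
  proof (rule ccontr)
    assume "\<not> q + m < N"
    moreover have "q < N" unfolding q_def N_def by simp
    ultimately have i: "q + m - N < m" "m - (q + m - N) = N - q" using m by auto
    have "N dvd k + (N - q)"
      unfolding q_def dvd_eq_mod_eq_0 using \<open>q < N\<close> q_def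
      by (metis mod_add_left_eq le_add_diff_inverse less_imp_le mod_self)
    with ndvd[OF i(1)] i(2) show False by simp
  qed
  define t0 where "t0 = drop (length y - (q + m)) y"
  show ?thesis
  proof
    show "m \<le> length t0" using qm by (simp add: t0_def N_def)
    have "depth t0 \<le> depth y" unfolding t0_def by (rule depth_mono) (rule suffix_drop)
    also have "depth y < depth s" by (simp add: H) (simp add: depth_def)
    finally show "depth t0 < depth s" .
    have "\<mu> (drop i t0) = \<mu> (drop i t)" if "i < m" for i
    proof -
      have "(k + (m - i)) mod N = (q + (m - i)) mod N"
        unfolding q_def by (simp add: mod_add_left_eq)
      then have "\<mu> (drop i t) = \<mu> ((tl ^^ (length y - (q + (m - i)))) y)"
        unfolding t_drop[OF less_imp_le[OF that]]
        using ndvd[OF that] qm that unfolding N_def by (intro \<mu>_rec) auto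
      also have "(tl ^^ (length y - (q + (m - i)))) y = drop i t0"
        unfolding funpow_tl_eq_drop t0_def using qm that by (simp add: N_def add.commute)
      finally show ?thesis by simp
    qed
    then show "path_colours t0 m = path_colours t m"
      by (simp add: path_colours_def)
  qed
qed

text \<open>The level counts the elements of \<open>F\<close> on the path from the root. It increases whenever a path
  enters a word in \<open>F\<close>, so level sets are the pieces that remain when the tree is cut there.\<close>
definition level :: "word set \<Rightarrow> word \<Rightarrow> nat"
  where "level F s = card {u \<in> F. suffix u s}"

lemma level_mono: "finite F \<Longrightarrow> suffix s t \<Longrightarrow> level F s \<le> level F t"
  unfolding level_def by (intro card_mono) (auto intro: suffix_order.order_trans)

lemma level_less:
  assumes "finite F" "i < m" "m \<le> length t" "drop i t \<in> F"
  shows "level F (drop m t) < level F t"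
  unfolding level_def
proof (rule psubset_card_mono)
  have "\<not> suffix (drop i t) (drop m t)"
    using assms suffix_length_le[of "drop i t" "drop m t"] by auto
  moreover have "suffix u t" if "suffix u (drop m t)" for u
    using that suffix_drop suffix_order.order_trans by blast
  ultimately show "{u \<in> F. suffix u (drop m t)} \<subset> {u \<in> F. suffix u t}"
    using assms(4) suffix_drop by blast
qed (use assms in simp)

lemma sum_inverse_powers_le: "0 \<le> K \<Longrightarrow> (\<Sum>m\<le>N. if m = 0 then 0 else K / 2 ^ m) \<le> (K :: real)"
proof -
  assume K: "0 \<le> K"
  have "(\<Sum>m\<le>N. if m = 0 then 0 else K / 2 ^ m) = K - K / 2 ^ N"
    by (induction N) (simp_all add: field_simps)
  with K show ?thesis by simp
qed

text \<open>A nonzero entry from \<open>s\<close> to \<open>t\<close> involves only colours in \<open>F\<close>. If \<open>s\<close> and \<open>t\<close> have the same level,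
  no word on the way belongs to \<open>F\<close>, so none is its own colour, and the entry is copied from a path
  of smaller depth. There it is bounded by the norm of the compression to smaller depth, and passing
  to the weights on the chain gains a factor \<open>1/2\<close> for each of the \<open>m \<ge> 1\<close> steps. In depth \<open>0\<close>
  there is no shallower path, and the compression vanishes.\<close>
lemma norm_compression_level_le:
  assumes X: "has_symbol X \<Phi> F" and F: "finite F"
  shows "norm (compression {s. depth s = j \<and> level F s = i} X)
    \<le> norm (compression {s. depth s < j} X)"
proof (rule norm_blinfun_bound)
  define E where "E = {s. depth s = j \<and> level F s = i}"
  define K where "K = norm (compression {s. depth s < j} X)"
  fix x
  define a :: "nat \<Rightarrow> real" where "a m = (if m = 0 then 0 else K / 2 ^ m)" for m
  define r where "r m t = (if take m t = replicate m G
    then Weight (drop m t) * cmod (coeff x (drop m t)) else 0)" for m t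
  have K: "0 \<le> K" by (simp add: K_def)
  have a: "0 \<le> a m" for m using K by (simp add: a_def)
  have r: "0 \<le> r m t" for m t using Weight_pos by (simp add: r_def less_imp_le)
  have term_le: "Weight t * cmod (\<Phi> (path_colours t m) * coeff x (drop m t)) \<le> a m * r m t"
    if m: "m \<le> length t" and E: "t \<in> E" "drop m t \<in> E" and nz: "\<Phi> (path_colours t m) \<noteq> 0" for t m
  proof -
    define s where "s = drop m t"
    have "0 < m"
      using nz has_symbolD(1)[OF X] by (cases m) (simp_all add: path_colours_def)
    have t: "t = replicate m G @ s"
      using replicate_G_if_depth_eq[of m t] E m by (simp add: E_def s_def)
    have "\<mu> (drop i' t) \<noteq> drop i' t" if "i' < m" for i'
    proof
      assume "\<mu> (drop i' t) = drop i' t"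
      then have "drop i' t \<in> set (path_colours t m)"
        using that by (force simp: path_colours_def)
      then have "drop i' t \<in> F" using has_symbolD(2)[OF X nz] by blast
      then show False
        using level_less[OF F that m] E by (simp add: E_def)
    qed
    then obtain t0 where t0: "m \<le> length t0" "depth t0 < depth s"
      "path_colours t0 m = path_colours t m"
      using chain_copies_shallower_path[OF t \<open>0 < m\<close>] by blast
    have "depth s = j" using E by (simp add: E_def s_def)
    have "depth (drop m t0) < j"
      using depth_mono[OF suffix_drop, of m t0] t0 \<open>depth s = j\<close> by simp
    then have entry: "cmod (\<Phi> (path_colours t m)) * Weight t0 \<le> K * Weight (drop m t0)"
      using compression_entry[OF X, of t0 "{s. depth s < j}" m] t0 \<open>depth s = j\<close>
      by (simp add: K_def)
    have "(1 / 2 ^ depth s) \<le> (1 / 2 ^ depth t0) * (1 / 2 :: real)"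
      using power_increasing[of "Suc (depth t0)" "depth s" "2 :: real"] t0(2)
      by (simp add: frac_le)
    then have "(1 / 2 ^ depth s) ^ m \<le> ((1 / 2 ^ depth t0) * (1 / 2 :: real)) ^ m"
      by (intro power_mono) auto
    then have pw: "(1 / 2 ^ depth s) ^ m \<le> (1 / 2 ^ depth t0) ^ m * (1 / 2 ^ m :: real)"
      by (simp add: power_mult_distrib power_one_over)
    define w where "w = Weight (drop m t0)"
    have w: "0 < w" unfolding w_def by (rule Weight_pos)
    have "Weight t * w = (1 / 2 ^ depth s) ^ m * w * Weight s"
      by (simp add: t Weight_replicate_G)
    also have "\<dots> \<le> ((1 / 2 ^ depth t0) ^ m * (1 / 2 ^ m)) * w * Weight s"
      using w Weight_pos[of s] by (intro mult_right_mono pw) auto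
    also have "\<dots> = ((1 / 2 ^ depth t0) ^ m * w) * (1 / 2 ^ m) * Weight s"
      by simp
    also have "\<dots> \<le> Weight t0 * (1 / 2 ^ m) * Weight s"
      unfolding w_def using Weight_pos[of s] by (intro mult_right_mono Weight_ge_drop) auto
    finally have Wt: "Weight t * w \<le> Weight t0 * (1 / 2 ^ m) * Weight s" .
    define p where "p = cmod (\<Phi> (path_colours t m))"
    have "p * Weight t * w \<le> p * (Weight t0 * (1 / 2 ^ m) * Weight s)"
      using mult_left_mono[OF Wt, of p] by (simp add: p_def mult.assoc)
    also have "\<dots> = (p * Weight t0) * ((1 / 2 ^ m) * Weight s)" by simp
    also have "\<dots> \<le> (K * w) * ((1 / 2 ^ m) * Weight s)"
      using entry Weight_pos[of s] unfolding p_def w_def by (intro mult_right_mono) auto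
    also have "\<dots> = (a m * Weight s) * w"
      using \<open>0 < m\<close> by (simp add: a_def)
    finally have "p * Weight t \<le> a m * Weight s"
      using w by (rule mult_right_le_imp_le)
    then have "p * Weight t * cmod (coeff x s) \<le> a m * Weight s * cmod (coeff x s)"
      by (rule mult_right_mono) simp
    moreover have "r m t = Weight s * cmod (coeff x s)"
      using t by (simp add: r_def)
    ultimately show ?thesis
      by (simp add: norm_mult p_def s_def mult_ac)
  qed
  have "norm (compression E X x) \<le> K * norm x"
  proof (rule norm_le_of_shift_bound[where a = a and R = "\<lambda>m t. take m t = replicate m G"])
    fix t
    show "Weight t * cmod (coeff (compression E X x) t)
      \<le> (\<Sum>m\<le>length t. a m * (if take m t = replicate m G
          then Weight (drop m t) * cmod (coeff x (drop m t)) else 0))"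
    proof (cases "t \<in> E")
      case True
      have "Weight t * cmod (coeff (compression E X x) t)
          = Weight t * cmod (\<Sum>m\<le>length t. \<Phi> (path_colours t m) * coeff (proj E x) (drop m t))"
        using True by (simp add: has_symbolD(3)[OF X])
      also have "\<dots> \<le> Weight t * (\<Sum>m\<le>length t. cmod (\<Phi> (path_colours t m) * coeff (proj E x) (drop m t)))"
        using Weight_pos[of t] by (intro mult_left_mono norm_sum) auto
      also have "\<dots> = (\<Sum>m\<le>length t. Weight t * cmod (\<Phi> (path_colours t m) * coeff (proj E x) (drop m t)))"
        by (rule sum_distrib_left)
      also have "\<dots> \<le> (\<Sum>m\<le>length t. a m * r m t)"
      proof (rule sum_mono)
        fix m assume "m \<in> {..length t}"
        then show "Weight t * cmod (\<Phi> (path_colours t m) * coeff (proj E x) (drop m t)) \<le> a m * r m t"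
          using term_le[of m t] True a[of m] r[of m t]
          by (cases "drop m t \<in> E \<and> \<Phi> (path_colours t m) \<noteq> 0") auto
      qed
      finally show ?thesis by (simp add: r_def)
    next
      case False
      then show ?thesis
        using a r by (auto intro!: sum_nonneg mult_nonneg_nonneg simp: r_def)
    qed
  next
    show "(\<Sum>m\<le>N. a m) \<le> K" for N
      unfolding a_def by (rule sum_inverse_powers_le[OF K])
    show "inj_on (drop m) {t. take m t = replicate m G \<and> m \<le> length t}" for m
      by (rule inj_onI) (metis (mono_tags, lifting) append_take_drop_id mem_Collect_eq)
  qed (rule a)
  then show "norm (compression {s. depth s = j \<and> level F s = i} X x)
      \<le> norm (compression {s. depth s < j} X) * norm x"
    unfolding E_def K_def .
qed simp


section \<open>Induction on the depth\<close>

lemma path_convex_levels: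
  fixes f g :: "word \<Rightarrow> nat"
  assumes "\<And>s t. suffix s t \<Longrightarrow> f s \<le> f t" "\<And>s t. suffix s t \<Longrightarrow> g s \<le> g t"
  shows "path_convex {s. f s = j \<and> g s = i}"
  unfolding path_convex_def mem_Collect_eq using assms by (metis order_antisym)

lemma opow_Suc_in_\<A>: "U \<in> \<A> \<Longrightarrow> opow U (Suc n) \<in> \<A>"
proof (induction n)
  case 0
  have "U o\<^sub>L id_blinfun = U" by (rule blinfun_eqI) simp
  with 0 show ?case by simp
next
  case (Suc n)
  then show ?case using subalgebra_\<A> unfolding subalgebra_def by simp
qed

text \<open>Replacing \<open>U\<^sup>k\<close> by an approximant \<open>X\<close> and back costs the approximation error twice: once in depth
  less than \<open>j\<close> and once on the layer. The constants \<open>1/4\<close> and \<open>1/8\<close> leave a norm below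
  \<open>1/4 + 2/8 < 1\<close>. The layers depend on \<open>X\<close>, but they are path-convex and finite in number
  whatever \<open>X\<close> is.\<close>
lemma summable_powers_depth_eq:
  assumes U: "U \<in> \<A>" and below: "summable_powers_on {s. depth s < j} U"
  shows "summable_powers_on {s. depth s = j} U"
proof -
  have "(\<lambda>n. norm (compression {s. depth s < j} (opow U n))) \<longlonglongrightarrow> 0"
    using below unfolding summable_powers_on_def by (rule summable_LIMSEQ_zero)
  then have "(\<lambda>n. norm (compression {s. depth s < j} (opow U (Suc n)))) \<longlonglongrightarrow> 0"
    by (rule LIMSEQ_Suc)
  then have "\<forall>\<^sub>F n in sequentially. norm (compression {s. depth s < j} (opow U (Suc n))) < 1 / 4"
    by (rule order_tendstoD) simp
  then obtain k where k: "norm (compression {s. depth s < j} (opow U (Suc k))) < 1 / 4"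
    using eventually_happens'[OF sequentially_bot] by blast
  obtain X where X: "X \<in> \<A>\<^sub>0" "norm (opow U (Suc k) - X) < 1 / 8"
    using \<A>_approx[OF opow_Suc_in_\<A>[OF U], of "1 / 8" k] by auto
  obtain \<Phi> F where F: "finite F" "has_symbol X \<Phi> F"
    using \<A>\<^sub>0_has_symbol[OF X(1)] by blast
  have "summable_powers_on {s \<in> {s. depth s = j}. level F s < card F + 1} U"
  proof (rule summable_powers_filtration)
    show "path_convex {s. depth s = j}"
      using path_convex_levels[of depth "\<lambda>_. 0" j 0] depth_mono by simp
    show "tree_local U" by (rule \<A>_tree_local[OF U])
    show "level F s \<le> level F t" if "suffix s t" for s t
      using level_mono[OF F(1) that] .
    fix i
    define E where "E = {s. depth s = j \<and> level F s = i}"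
    have "norm (compression E (opow U (Suc k))) \<le> norm (compression E X) + norm (opow U (Suc k) - X)"
      by (rule norm_compression_close)
    also have "norm (compression E X) \<le> norm (compression {s. depth s < j} X)"
      unfolding E_def by (rule norm_compression_level_le[OF F(2,1)])
    also have "norm (compression {s. depth s < j} X)
        \<le> norm (compression {s. depth s < j} (opow U (Suc k))) + norm (X - opow U (Suc k))"
      by (rule norm_compression_close)
    finally have "norm (compression E (opow U (Suc k))) < 1"
      using k X(2) norm_minus_commute[of X "opow U (Suc k)"] by linarith
    then have "summable_powers_on E U"
      using \<A>_tree_local[OF U] path_convex_levels[of depth "level F" j i] depth_mono level_mono[OF F(1)]
      by (intro summable_powers_of_contraction[where k = "Suc k"]) (auto simp: E_def simp del: opow.simps)
    then show "summable_powers_on {s \<in> {s. depth s = j}. level F s = i} U"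
      by (simp add: E_def)
  qed
  moreover have "level F s < card F + 1" for s
    unfolding level_def using F(1) card_mono[of F "{u \<in> F. suffix u s}"] by (simp add: less_Suc_eq_le)
  ultimately show ?thesis by simp
qed

lemma summable_powers_depth_less:
  assumes U: "U \<in> \<A>"
  shows "summable_powers_on {s. depth s < j} U"
proof (induction j rule: less_induct)
  case (less j)
  have "summable_powers_on {s \<in> UNIV. depth s < j} U"
  proof (rule summable_powers_filtration[OF _ depth_mono \<A>_tree_local[OF U]])
    show "path_convex UNIV" by (simp add: path_convex_def)
    show "summable_powers_on {s \<in> UNIV. depth s = i} U" if "i < j" for i
      using summable_powers_depth_eq[OF U less[OF that]] by simp
  qed
  then show ?case by simp
qed

text \<open>A step from \<open>s\<close> to \<open>t\<close> multiplies \<open>Weight s\<close> by \<open>weight t\<close>, and \<open>t\<close> is at least as deep as \<open>s\<close>.\<close>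
lemma norm_T_deep: "norm (T c o\<^sub>L proj {s. d \<le> depth s}) \<le> 1 / 2 ^ d"
proof (rule norm_blinfun_bound)
  fix x
  define y where "y = proj {s. d \<le> depth s} x"
  have "norm (T c y) \<le> 1 / 2 ^ d * norm x"
  proof (rule norm_le_of_shift_bound[where R = "\<lambda>m t. m = 1 \<and> \<mu> t = c"
        and a = "\<lambda>m. if m = 1 then 1 / 2 ^ d else 0"])
    fix t
    show "Weight t * cmod (coeff (T c y) t) \<le> (\<Sum>m\<le>length t. (if m = 1 then 1 / 2 ^ d else 0)
        * (if m = 1 \<and> \<mu> t = c then Weight (drop m t) * cmod (coeff x (drop m t)) else 0))"
      (is "_ \<le> ?rhs")
    proof (cases t)
      case (Cons a s)
      have "?rhs = (\<Sum>m\<le>length t. if m = 1 then 1 / 2 ^ d *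
          (if \<mu> t = c then Weight (drop 1 t) * cmod (coeff x (drop 1 t)) else 0) else 0)"
        by (rule sum.cong) auto
      also have "\<dots> = 1 / 2 ^ d * (if \<mu> t = c then Weight s * cmod (coeff x s) else 0)"
        by (simp add: Cons del: sum.atMost_Suc)
      finally have rhs: "?rhs = 1 / 2 ^ d * (if \<mu> t = c then Weight s * cmod (coeff x s) else 0)" .
      show ?thesis
      proof (cases "\<mu> t = c \<and> d \<le> depth s")
        case True
        then have "d \<le> depth t" using depth_mono[of s t] by (simp add: Cons suffix_ConsI)
        then have "weight t \<le> 1 / 2 ^ d" by (simp add: weight_def frac_le power_increasing)
        then have "Weight t \<le> 1 / 2 ^ d * Weight s"
          unfolding Cons Weight_Cons using Weight_pos[of s] by (intro mult_right_mono) auto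
        then have "Weight t * cmod (coeff x s) \<le> 1 / 2 ^ d * Weight s * cmod (coeff x s)"
          by (rule mult_right_mono) simp
        with True show ?thesis unfolding rhs by (simp add: Cons T.rep_eq y_def)
      next
        case False
        then have "coeff (T c y) t = 0" by (auto simp: Cons T.rep_eq y_def)
        then show ?thesis unfolding rhs using Weight_pos[of s] by simp
      qed
    qed (simp add: T.rep_eq)
  next
    fix m
    show "inj_on (drop m) {t. (m = 1 \<and> \<mu> t = c) \<and> m \<le> length t}"
    proof (rule inj_onI)
      fix t u assume *: "t \<in> {t. (m = 1 \<and> \<mu> t = c) \<and> m \<le> length t}"
        "u \<in> {t. (m = 1 \<and> \<mu> t = c) \<and> m \<le> length t}" "drop m t = drop m u"
      then obtain a b s where "t = a # s" "u = b # s"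
        by (cases t; cases u) auto
      with * show "t = u"
        using \<mu>_children_neq[of s] by (cases a; cases b) auto
    qed
  qed simp_all
  then show "norm ((T c o\<^sub>L proj {s. d \<le> depth s}) x) \<le> 1 / 2 ^ d * norm x"
    by (simp add: y_def)
qed simp

lemma \<A>\<^sub>0_deep_tendsto_0:
  assumes "X \<in> \<A>\<^sub>0"
  shows "(\<lambda>d. X o\<^sub>L proj {s. d \<le> depth s}) \<longlonglongrightarrow> 0"
  using assms
proof (induction rule: \<A>\<^sub>0_induct)
  case (generator c)
  have "(\<lambda>d. 1 / 2 ^ d :: real) \<longlonglongrightarrow> 0"
    by (simp add: LIMSEQ_divide_realpow_zero)
  then show ?case
    by (rule Lim_null_comparison[rotated]) (simp add: norm_T_deep)
next
  case zero
  then show ?case by simp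
next
  case (add X Y)
  have "(X + Y) o\<^sub>L P = (X o\<^sub>L P) + (Y o\<^sub>L P)" for P :: "hilb \<Rightarrow>\<^sub>L hilb"
    by (rule blinfun_eqI) (simp add: blinfun.add_left)
  then show ?case using tendsto_add[OF add] by simp
next
  case (scale c X)
  have "(cscale_op c o\<^sub>L X) o\<^sub>L P = cscale_op c o\<^sub>L (X o\<^sub>L P)" for P :: "hilb \<Rightarrow>\<^sub>L hilb"
    by (rule blinfun_eqI) simp
  then show ?case
    using bounded_bilinear.tendsto[OF bounded_bilinear_blinfun_compose tendsto_const scale, of "cscale_op c"] by simp
next
  case (compose X Y)
  have "(X o\<^sub>L Y) o\<^sub>L P = X o\<^sub>L (Y o\<^sub>L P)" for P :: "hilb \<Rightarrow>\<^sub>L hilb"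
    by (rule blinfun_eqI) simp
  then show ?case
    using bounded_bilinear.tendsto[OF bounded_bilinear_blinfun_compose tendsto_const compose(2), of X] by simp
qed

lemma summable_norm_opow:
  assumes U: "U \<in> \<A>"
  shows "summable (\<lambda>n. norm (opow U n))"
proof -
  obtain X where X: "X \<in> \<A>\<^sub>0" "norm (U - X) < 1 / 2"
    using \<A>_approx[OF U, of "1 / 2"] by auto
  have "(\<lambda>d. norm (X o\<^sub>L proj {s. d \<le> depth s})) \<longlonglongrightarrow> 0"
    using tendsto_norm[OF \<A>\<^sub>0_deep_tendsto_0[OF X(1)]] by simp
  then have "\<forall>\<^sub>F d in sequentially. norm (X o\<^sub>L proj {s. d \<le> depth s}) < 1 / 2"
    by (rule order_tendstoD) simp
  then obtain d where d: "norm (X o\<^sub>L proj {s. d \<le> depth s}) < 1 / 2"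
    using eventually_happens'[OF sequentially_bot] by blast
  define D where "D = {s. d \<le> depth s}"
  have "compression D X = proj D o\<^sub>L (X o\<^sub>L proj D)"
    by (rule blinfun_eqI) simp
  then have "norm (compression D X) \<le> 1 * norm (X o\<^sub>L proj D)"
    by (simp only:) (intro norm_compose_le norm_proj_le order_refl)
  then have "norm (compression D U) < 1"
    using norm_compression_close[of D U X] X(2) d by (simp add: D_def)
  moreover have "opow U 1 = U" by (rule blinfun_eqI) simp
  moreover have "path_convex D"
    unfolding path_convex_def D_def using depth_mono order_trans by blast
  ultimately have deep: "summable_powers_on D U"
    using \<A>_tree_local[OF U] by (intro summable_powers_of_contraction[where k = 1]) auto
  have "{s. depth s < d} \<union> D = UNIV" by (auto simp: D_def)
  moreover have "summable_powers_on ({s. depth s < d} \<union> D) U"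
  proof (rule summable_powers_triangular[OF _ _ _ \<A>_tree_local[OF U] _ deep])
    show "summable_powers_on {s. depth s < d} U" by (rule summable_powers_depth_less[OF U])
    show "path_convex ({s. depth s < d} \<union> D)"
      unfolding \<open>_ = UNIV\<close> by (simp add: path_convex_def)
    show "\<not> suffix s t" if "s \<in> D" "t \<in> {s. depth s < d}" for s t
      using that depth_mono[of s t] by (auto simp: D_def)
  qed (auto simp: D_def)
  moreover have "compression UNIV Y = Y" for Y
  proof (rule blinfun_eqI)
    have "proj UNIV y = y" for y by (rule hilb_eqI) simp
    then show "compression UNIV Y x = Y x" for x by simp
  qed
  ultimately show ?thesis by (simp add: summable_powers_on_def)
qed


section \<open>Quasi-inverses and the radical\<close>

text \<open>The quasi-inverse \<open>U + U\<^sup>2 + \<dots>\<close> starts with the first power, so its partial sums lie in the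
  non-unital algebra \<open>\<A>\<close>, which is closed.\<close>
lemma left_quasi_inverse:
  assumes U: "U \<in> \<A>"
  obtains V where "V \<in> \<A>" "V - (V o\<^sub>L U) = U"
proof -
  note sub = subalgebra_\<A>[unfolded subalgebra_def]
  define V where "V = (\<Sum>n. opow U (Suc n))"
  have s: "summable (opow U)" by (rule summable_norm_cancel[OF summable_norm_opow[OF U]])
  then have s1: "summable (\<lambda>n. opow U (Suc n))" by (subst summable_Suc_iff)
  have "V \<in> \<A>"
  proof (rule closed_sequentially)
    show "closed \<A>" by (simp add: \<A>_def)
    show "(\<lambda>n. \<Sum>i<n. opow U (Suc i)) \<longlonglongrightarrow> V"
      unfolding V_def by (rule summable_LIMSEQ[OF s1])
    show "(\<Sum>i<n. opow U (Suc i)) \<in> \<A>" for n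
      by (induction n) (use sub opow_Suc_in_\<A>[OF U] in \<open>simp_all del: opow.simps\<close>)
  qed
  moreover have "V - (V o\<^sub>L U) = U"
  proof -
    have one: "opow U 1 = U" by (rule blinfun_eqI) simp
    have "opow U n o\<^sub>L U = opow U (Suc n)" for n
      using opow_add[of U n 1] one by (simp del: opow.simps)
    then have "V o\<^sub>L U = (\<Sum>n. opow U (Suc (Suc n)))"
      unfolding V_def using bounded_linear.suminf[OF
          bounded_bilinear.bounded_linear_left[OF bounded_bilinear_blinfun_compose, of U] s1]
      by (simp del: opow.simps)
    moreover have "(\<Sum>n. opow U (Suc (Suc n))) = V - opow U (Suc 0)"
      unfolding V_def by (rule suminf_split_head[OF s1])
    ultimately show ?thesis using one by simp
  qed
  ultimately show ?thesis by (rule that)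
qed

text \<open>If \<open>U\<close> is a right identity modulo \<open>L\<close> and \<open>V\<close> is a left quasi-inverse of \<open>U\<close>, then
  \<open>U = V - V U\<close> lies in \<open>L\<close>, and with it every \<open>A = (A - A U) + A U\<close>.\<close>
lemma modular_left_ideal_eq:
  assumes "modular_left_ideal \<A> L"
  shows "L = \<A>"
proof -
  obtain U where L: "left_ideal \<A> L" and U: "U \<in> \<A>" and mod: "\<And>A. A \<in> \<A> \<Longrightarrow> A - (A o\<^sub>L U) \<in> L"
    using assms unfolding modular_left_ideal_def by blast
  obtain V where "V \<in> \<A>" "V - (V o\<^sub>L U) = U"
    using left_quasi_inverse[OF U] .
  then have "U \<in> L" using mod by metis
  have "A \<in> L" if "A \<in> \<A>" for A
  proof -
    have "(A - (A o\<^sub>L U)) + (A o\<^sub>L U) \<in> L"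
      using L mod[OF that] that \<open>U \<in> L\<close> unfolding left_ideal_def by blast
    then show ?thesis by simp
  qed
  then show ?thesis using L unfolding left_ideal_def by blast
qed

theorem theorem3p3:
  shows "radical_algebra \<A>"
  using modular_left_ideal_eq
  unfolding radical_algebra_def jacobson_radical_def maximal_modular_left_ideal_def by blast

end
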